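(* For each $n\ge 1$ let $\theta_0=\theta_0(n)\in(-\frac{\pi}{2n},\frac{\pi}{2n})$ be arbitrary, let $\tilde\theta_k^{(n)}=\frac{(2k-1)\pi}{2n}-\theta_0$ for $k=1,\dots,n$, and let $\mathcal{G}_n$ be the Grünwald operator associated with the nodes $\{\cos\tilde\theta_k^{(n)}\}_{k=1}^n$. Let $f\in C^2[0,\pi]$ and $\theta\in[0,\pi]$. Then $$\limsup_{n\to\infty} n^{1/3}\,|\mathcal{G}_n(f)(\theta)-f(\theta)|\le\left(\frac{9\pi^4}{64}+c_2\right)|f'(\theta)|+\frac{9\pi^5}{128}|f''(\theta)|+\frac{9M\pi^5}{64},$$ where $M=\|f''\|_\infty$ and $$c_2=\frac{48}{\pi}+\frac{9\pi^3}{64n^2}\sum_{k=1}^\infty\Big(\frac{2n}{\pi}\Big)^2\frac1{k^2}$$ (a constant independent of $n$).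
   Context: Given distinct nodes $x_k=\cos\eta_k$, $k=1,\dots,n$, with $\eta_k\in[0,\pi]$, the fundamental polynomials of Lagrange interpolation, written in the variable $x=\cos\theta$, are $$l_k(\theta)=\frac{\zeta(\cos\theta)}{\zeta'(x_k)(\cos\theta-x_k)},\qquad \zeta(x)=\prod_{j=1}^n(x-x_j)$$ (with the value at a removable singularity given by continuity). For $g\in C[0,\pi]$ the Grünwald operator $\mathcal{G}_n:C[0,\pi]\to C[0,\pi]$ is $$\mathcal{G}_n(g)(\theta)=\frac12\sum_{k=1}^n g(\eta_k)\Big\{l_k\big(\theta-\tfrac{\pi}{2n}\big)+l_k\big(\theta+\tfrac{\pi}{2n}\big)\Big\}.$$ In the claim, $\eta_k=\tilde\theta_k^{(n)}$. $C^2[0,\pi]$ is the space of twice continuously differentiable real functions on $[0,\pi]$, and $\|\cdot\|_\infty$ is the supremum norm on $[0,\pi]$. *)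

theory Defs
  imports "HOL-Analysis.Analysis" "HOL-Computational_Algebra.Polynomial"
begin

text \<open>The nodes are \<open>cos (\<eta> k)\<close> for \<open>k = 1, \<dots>, n\<close>.\<close>

definition node_poly :: "nat \<Rightarrow> (nat \<Rightarrow> real) \<Rightarrow> real poly" where
  "node_poly n \<eta> = (\<Prod>j=1..n. [:- cos (\<eta> j), 1:])"

text \<open>
  Where \<open>cos t = cos (\<eta> k)\<close> the quotient is \<open>0 / 0\<close>. The value by continuity there
  is 1; lemma \<open>continuous_on_lagrange_fund\<close> confirms that this is the continuous extension.
\<close>

definition lagrange_fund :: "nat \<Rightarrow> (nat \<Rightarrow> real) \<Rightarrow> nat \<Rightarrow> real \<Rightarrow> real" where
  "lagrange_fund n \<eta> k t =
     (if cos t = cos (\<eta> k) then 1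
      else poly (node_poly n \<eta>) (cos t) /
           (poly (pderiv (node_poly n \<eta>)) (cos (\<eta> k)) * (cos t - cos (\<eta> k))))"

definition grunwald :: "nat \<Rightarrow> (nat \<Rightarrow> real) \<Rightarrow> (real \<Rightarrow> real) \<Rightarrow> real \<Rightarrow> real" where
  "grunwald n \<eta> g t =
     1 / 2 * (\<Sum>k=1..n. g (\<eta> k) *
       (lagrange_fund n \<eta> k (t - pi / (2 * real n)) + lagrange_fund n \<eta> k (t + pi / (2 * real n))))"

definition shifted_angle :: "nat \<Rightarrow> real \<Rightarrow> nat \<Rightarrow> real" where
  "shifted_angle n \<theta>0 k = (2 * real k - 1) * pi / (2 * real n) - \<theta>0"

text \<open>
  The series over \<open>k \<ge> 1\<close> is indexed from 0 through \<open>Suc k\<close>. For \<open>n \<ge> 1\<close> the value does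
  not depend on \<open>n\<close>, see \<open>c2_indep\<close> below.
\<close>

definition c2 :: "nat \<Rightarrow> real" where
  "c2 n = 48 / pi + 9 * pi ^ 3 / (64 * real n ^ 2) *
     (\<Sum>k. (2 * real n / pi) ^ 2 * (1 / real (Suc k) ^ 2))"

lemma c2_indep:
  assumes "n \<ge> 1"
  shows "c2 n = c2 1"
proof -
  have s: "summable (\<lambda>k. 1 / real (Suc k) ^ 2)"
    using inverse_power_summable[of 2, where 'a = real]
    by (subst summable_Suc_iff[where f = "\<lambda>k. 1 / real k ^ 2"]) (simp add: inverse_eq_divide)
  define S where "S = (\<Sum>k. 1 / real (Suc k) ^ 2)"
  have e: "c2 N = 48 / pi + 9 * pi ^ 3 / (64 * real N ^ 2) * ((2 * real N / pi) ^ 2 * S)" for N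
    unfolding c2_def S_def suminf_mult[OF s] ..
  have "9 * pi ^ 3 / (64 * real N ^ 2) * ((2 * real N / pi) ^ 2 * S) = 9 * pi / 16 * S"
    if "N \<ge> 1" for N
    using that by (simp add: power2_eq_square power3_eq_cube)
  then show ?thesis using assms by (simp only: e order_refl)
qed

lemma lagrange_fund_eq_prod:
  assumes inj: "inj_on (\<lambda>j. cos (\<eta> j)) {1..n}" and k: "k \<in> {1..n}"
  shows "lagrange_fund n \<eta> k t =
    (\<Prod>j\<in>{1..n} - {k}. (cos t - cos (\<eta> j)) / (cos (\<eta> k) - cos (\<eta> j)))"
proof -
  define q where "q = (\<Prod>j\<in>{1..n} - {k}. [:- cos (\<eta> j), 1:])"
  have p: "node_poly n \<eta> = [:- cos (\<eta> k), 1:] * q"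
    unfolding node_poly_def q_def using k by (subst prod.remove[of _ k]) auto
  have d: "poly (pderiv (node_poly n \<eta>)) (cos (\<eta> k)) = poly q (cos (\<eta> k))"
    unfolding p pderiv_mult by (simp add: pderiv_pCons)
  have q: "poly q x = (\<Prod>j\<in>{1..n} - {k}. (x - cos (\<eta> j)))" for x
    unfolding q_def by (simp add: poly_prod)
  have nz: "cos (\<eta> k) - cos (\<eta> j) \<noteq> 0" if "j \<in> {1..n} - {k}" for j
    using inj_onD[OF inj, of k j] that k by auto
  have nzq: "poly q (cos (\<eta> k)) \<noteq> 0"
    unfolding q using nz by (simp add: prod_zero_iff)
  have "lagrange_fund n \<eta> k t = poly q (cos t) / poly q (cos (\<eta> k))"
  proof (cases "cos t = cos (\<eta> k)")
    case True
    then show ?thesis using nzq by (simp add: lagrange_fund_def)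
  next
    case False
    then have "cos t - cos (\<eta> k) \<noteq> 0" by simp
    moreover have "poly (node_poly n \<eta>) (cos t) = (cos t - cos (\<eta> k)) * poly q (cos t)"
      unfolding p by (simp add: algebra_simps)
    ultimately show ?thesis
      using False unfolding lagrange_fund_def d by simp
  qed
  then show ?thesis by (simp add: q prod_dividef)
qed

lemma continuous_on_lagrange_fund:
  assumes "inj_on (\<lambda>j. cos (\<eta> j)) {1..n}" and "k \<in> {1..n}"
  shows "continuous_on UNIV (lagrange_fund n \<eta> k)"
proof -
  have "lagrange_fund n \<eta> k =
    (\<lambda>t. \<Prod>j\<in>{1..n} - {k}. (cos t - cos (\<eta> j)) * inverse (cos (\<eta> k) - cos (\<eta> j)))"
    using lagrange_fund_eq_prod[OF assms] by (simp only: fun_eq_iff divide_inverse) simp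
  then show ?thesis by (simp only:) (intro continuous_intros)
qed

lemma shifted_angle_in:
  assumes "n \<ge> 1" and "\<theta>0 \<in> {- (pi / (2 * real n))<..<pi / (2 * real n)}" and "k \<in> {1..n}"
  shows "shifted_angle n \<theta>0 k \<in> {0<..<pi}"
proof -
  have h: "pi / (2 * real n) > 0" using assms by simp
  have e: "shifted_angle n \<theta>0 k = (2 * real k - 1) * (pi / (2 * real n)) - \<theta>0"
    by (simp add: shifted_angle_def)
  have "1 * (pi / (2 * real n)) \<le> (2 * real k - 1) * (pi / (2 * real n))"
    using assms h by (intro mult_right_mono) auto
  moreover have "(2 * real k - 1) * (pi / (2 * real n)) \<le> (2 * real n - 1) * (pi / (2 * real n))"
    using assms h by (intro mult_right_mono) auto
  moreover have "(2 * real n - 1) * (pi / (2 * real n)) = pi - pi / (2 * real n)"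
    using assms by (simp add: field_simps)
  ultimately show ?thesis using assms(2) unfolding e by auto
qed

lemma inj_on_cos_shifted_angle:
  assumes "n \<ge> 1" and "\<theta>0 \<in> {- (pi / (2 * real n))<..<pi / (2 * real n)}"
  shows "inj_on (\<lambda>j. cos (shifted_angle n \<theta>0 j)) {1..n}"
proof (rule inj_onI)
  fix i j assume ij: "i \<in> {1..n}" "j \<in> {1..n}"
    "cos (shifted_angle n \<theta>0 i) = cos (shifted_angle n \<theta>0 j)"
  have "0 \<le> shifted_angle n \<theta>0 i" "shifted_angle n \<theta>0 i \<le> pi"
    "0 \<le> shifted_angle n \<theta>0 j" "shifted_angle n \<theta>0 j \<le> pi"
    using shifted_angle_in[OF assms ij(1)] shifted_angle_in[OF assms ij(2)]
    by (simp_all only: greaterThanLessThan_iff less_imp_le)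
  then have "shifted_angle n \<theta>0 i = shifted_angle n \<theta>0 j"
    using ij(3) by (rule cos_inj_pi)
  then have "(2 * real i - 1) * pi / (2 * real n) = (2 * real j - 1) * pi / (2 * real n)"
    unfolding shifted_angle_def by linarith
  moreover have "pi \<noteq> 0" "2 * real n \<noteq> 0" using assms(1) by auto
  ultimately have "2 * real i - 1 = 2 * real j - 1"
    by (simp only: divide_cancel_right mult_cancel_right) simp
  then show "i = j" by simp
qed

end

theory Submission
  imports Defs
begin

text \<open>
  The weighted error even tends to 0: the error itself is at most of order \<open>n powr (- 1/2)\<close>. The
  right-hand side is nonnegative, so the inequality follows. The order \<open>n powr (- 1/2)\<close> comes from Lagrange
  interpolation alone (\<open>lagrange_interpolation_error\<close>), without any cancellation between the two
  summands of the Gruenwald operator, and rests on three facts.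

  First, the fundamental polynomials are bounded by 4, uniformly in the shift, at all points whose
  distance from 0 and \<open>pi\<close> is at least \<open>pi / (2 n)\<close> (\<open>abs_lagrange_fund_le\<close>). With a shift \<open>d\<close> the nodal
  product equals a constant times \<open>A t * cos (n (t + d))\<close> with a positive amplitude \<open>A\<close>. For \<open>d \<ge> 0\<close>
  the amplitude is increasing in \<open>t\<close>, and the ratio \<open>A b / A a\<close> for \<open>a \<le> b\<close> is increasing in \<open>d\<close>; for
  the extreme shift the amplitude telescopes to \<open>tan (t / 2)\<close>. This leaves explicit trigonometric
  quotients. Negative shifts are reflected. The points \<open>\<theta> - pi / (2 n)\<close> and \<open>\<theta> + pi / (2 n)\<close> at which
  the operator evaluates the fundamental polynomials are admissible for large \<open>n\<close>, if need be after
  reflection at an end point.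

  Secondly, \<open>f\<close> is a cosine polynomial of degree less than \<open>n\<close>, which interpolation reproduces, plus
  a remainder (\<open>cos_sum_plus_green_rem\<close>). The even \<open>2 pi\<close>-periodic extension of \<open>f\<close> has kinks at 0 and
  \<open>pi\<close>, so in general the remainder is no better than \<open>1 / n\<close> uniformly. It is, however, a superposition
  of translates of one function, the tail of the series of \<open>cos (k x) / k^2\<close>, which is bounded both
  by a multiple of \<open>1 / n\<close> and by a multiple of \<open>1 / (n^2 \<bar>sin (x / 2)\<bar>)\<close> (\<open>sq_series_rem_decay\<close>).

  Thirdly, by counting nodes near the singularity, the sum over the nodes of the absolute values of
  any such translate is at most of order \<open>n powr (- 1/2)\<close> (\<open>sum_sq_series_rem_nodes_le\<close>).
\<close>

section \<open>Lagrange interpolation reproduces cosine polynomials\<close>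

lemma cos_multiple_poly:
  "\<exists>p::real poly. degree p \<le> i \<and> (\<forall>t. poly p (cos t) = cos (real i * t))"
proof (induction i rule: less_induct)
  case (less i)
  consider "i = 0" | "i = 1" | j where "i = Suc (Suc j)"
    by (metis One_nat_def not0_implies_Suc)
  then show ?case
  proof cases
    case 1
    then show ?thesis by (intro exI[of _ "[:1:]"]) auto
  next
    case 2
    then show ?thesis by (intro exI[of _ "[:0, 1:]"]) auto
  next
    case 3
    obtain p where p: "degree p \<le> Suc j" "\<And>t. poly p (cos t) = cos (real (Suc j) * t)"
      using less[of "Suc j"] 3 by auto
    obtain q where q: "degree q \<le> j" "\<And>t. poly q (cos t) = cos (real j * t)"
      using less[of j] 3 by auto
    have "cos (real i * t) = 2 * cos t * cos (real (Suc j) * t) - cos (real j * t)" for t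
      using cos_times_cos[of "real (Suc j) * t" t] unfolding 3
      by (simp add: algebra_simps)
    then have "poly ([:0, 2:] * p - q) (cos t) = cos (real i * t)" for t
      by (simp add: p q algebra_simps)
    moreover have "degree ([:0, 2:] * p - q) \<le> i"
    proof (rule degree_diff_le)
      show "degree ([:0, 2:] * p) \<le> i"
        using degree_mult_le[of "[:0, 2:]" p] p(1) unfolding 3 by simp
      show "degree q \<le> i" using q(1) unfolding 3 by simp
    qed
    ultimately show ?thesis by blast
  qed
qed

lemma lagrange_fund_reproduces_poly:
  assumes inj: "inj_on (\<lambda>j. cos (\<eta> j)) {1..n}" and p: "degree p < n"
  shows "(\<Sum>k=1..n. poly p (cos (\<eta> k)) * lagrange_fund n \<eta> k t) = poly p (cos t)"
proof -
  define x where "x j = cos (\<eta> j)" for j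
  define L where "L k = (\<Prod>j\<in>{1..n} - {k}. smult (inverse (x k - x j)) [:- x j, 1:])" for k
  have polyL: "poly (L k) y = (\<Prod>j\<in>{1..n} - {k}. (y - x j) / (x k - x j))" for k y
    unfolding L_def poly_prod by (intro prod.cong) (auto simp: divide_inverse algebra_simps)
  have degL: "degree (L k) < n" if "k \<in> {1..n}" for k
  proof -
    have deg1: "degree (smult (inverse (x k - x j)) [:- x j, 1:]) \<le> 1" for j
      by (rule order_trans[OF degree_smult_le]) simp
    have "degree (L k) \<le> (\<Sum>j\<in>{1..n} - {k}. degree (smult (inverse (x k - x j)) [:- x j, 1:]))"
      unfolding L_def by (rule degree_prod_sum_le[unfolded o_def]) simp
    also have "\<dots> \<le> (\<Sum>j\<in>{1..n} - {k}. 1)"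
      using deg1 by (intro sum_mono)
    also have "\<dots> < n" using that by simp
    finally show ?thesis .
  qed
  have Lx: "poly (L k) (x i) = (if i = k then 1 else 0)" if "k \<in> {1..n}" "i \<in> {1..n}" for i k
  proof (cases "i = k")
    case True
    have "x k - x j \<noteq> 0" if "j \<in> {1..n} - {k}" for j
      using inj_onD[OF inj, of k j] that \<open>k \<in> {1..n}\<close> by (auto simp: x_def)
    then show ?thesis using True by (auto simp: polyL intro!: prod.neutral)
  next
    case False
    then show ?thesis using that by (auto simp: polyL prod_zero_iff)
  qed
  have "(\<Sum>k=1..n. smult (poly p (x k)) (L k)) = p"
  proof (rule poly_eqI_degree[where A = "x ` {1..n}"])
    have c: "card (x ` {1..n}) = n"
      using card_image[OF inj] by (simp add: x_def)
    have n: "0 < n" using p by simp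
    show "degree (\<Sum>k=1..n. smult (poly p (x k)) (L k)) < card (x ` {1..n})"
      unfolding c using degL n
      by (intro degree_sum_less) (auto intro: le_less_trans[OF degree_smult_le])
    show "degree p < card (x ` {1..n})" using p c by simp
    fix y assume "y \<in> x ` {1..n}"
    then obtain i where i: "i \<in> {1..n}" "y = x i" by blast
    have "poly (\<Sum>k=1..n. smult (poly p (x k)) (L k)) y
        = (\<Sum>k=1..n. poly p (x k) * (if i = k then 1 else 0))"
      unfolding poly_sum i(2) poly_smult using Lx i by (intro sum.cong) auto
    also have "\<dots> = (\<Sum>k=1..n. if i = k then poly p (x k) else 0)"
      by (intro sum.cong) auto
    also have "\<dots> = poly p y"
      using i by simp
    finally show "poly (\<Sum>k=1..n. smult (poly p (x k)) (L k)) y = poly p y" .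
  qed
  then have "poly p (cos t) = (\<Sum>k=1..n. poly p (x k) * poly (L k) (cos t))"
    by (metis (mono_tags, lifting) poly_smult poly_sum sum.cong)
  also have "\<dots> = (\<Sum>k=1..n. poly p (cos (\<eta> k)) * lagrange_fund n \<eta> k t)"
    using lagrange_fund_eq_prod[OF inj] by (intro sum.cong) (auto simp: polyL x_def)
  finally show ?thesis ..
qed

lemma lagrange_fund_reproduces_cos_sum:
  assumes inj: "inj_on (\<lambda>j. cos (\<eta> j)) {1..n}" and "m < n"
  shows "(\<Sum>k=1..n. (\<Sum>i\<le>m. c i * cos (real i * \<eta> k)) * lagrange_fund n \<eta> k t)
    = (\<Sum>i\<le>m. c i * cos (real i * t))"
proof -
  obtain p where p: "\<And>i. degree (p i) \<le> i" "\<And>i t. poly (p i) (cos t) = cos (real i * t)"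
    using cos_multiple_poly by metis
  define q where "q = (\<Sum>i\<le>m. smult (c i) (p i))"
  have "degree (smult (c i) (p i)) \<le> m" if "i \<le> m" for i
    using degree_smult_le[of "c i" "p i"] p(1)[of i] that by linarith
  then have "degree q \<le> m"
    unfolding q_def by (intro degree_sum_le) auto
  then have "degree q < n" using \<open>m < n\<close> by simp
  moreover have "poly q (cos t) = (\<Sum>i\<le>m. c i * cos (real i * t))" for t
    unfolding q_def by (simp add: poly_sum p(2))
  ultimately show ?thesis
    using lagrange_fund_reproduces_poly[OF inj, of q t] by simp
qed

text \<open>
  The unshifted nodes are the Chebyshev nodes, the zeros of \<open>cos (n y)\<close>. The value of the
  constant plays no role, because it cancels in every fundamental polynomial.
\<close>

lemma cos_multiple_eq_prod:
  assumes "n \<ge> 1"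
  shows "\<exists>c. c \<noteq> 0 \<and> (\<forall>y. c * cos (real n * y) = (\<Prod>j=1..n. cos y - cos (shifted_angle n 0 j)))"
proof -
  define s where "s = shifted_angle n 0"
  obtain p where p: "degree p \<le> n" "\<And>t. poly p (cos t) = cos (real n * t)"
    using cos_multiple_poly by metis
  define q where "q = (\<Prod>j=1..n. [:- cos (s j), 1:])"
  have inj: "inj_on (\<lambda>j. cos (s j)) {1..n}"
    unfolding s_def using assms by (intro inj_on_cos_shifted_angle) auto
  have q: "poly q y = (\<Prod>j=1..n. y - cos (s j))" for y
    unfolding q_def by (simp add: poly_prod)
  have dq: "degree q = n"
    unfolding q_def by (subst degree_prod_eq_sum_degree) auto
  have lq: "lead_coeff q = 1"
    unfolding q_def by (subst lead_coeff_prod) auto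
  have "p = smult (coeff p n) q"
  proof (rule poly_eqI_degree_lead_coeff[where A = "(\<lambda>j. cos (s j)) ` {1..n}"])
    show "coeff p n = coeff (smult (coeff p n) q) n" using lq dq by simp
    show "card ((\<lambda>j. cos (s j)) ` {1..n}) \<ge> n" using card_image[OF inj] by simp
    show "degree p \<le> n" by fact
    show "degree (smult (coeff p n) q) \<le> n" using dq degree_smult_le[of "coeff p n" q] by simp
    fix z assume "z \<in> (\<lambda>j. cos (s j)) ` {1..n}"
    then obtain j where j: "j \<in> {1..n}" "z = cos (s j)" by blast
    have "real n * s j = (real j * pi) - pi / 2"
      using assms by (simp add: s_def shifted_angle_def field_simps)
    then have "cos (real n * s j) = 0"
      by (simp add: cos_diff)
    moreover have "poly q (cos (s j)) = 0"
      unfolding q using j by (auto simp: prod_zero_iff)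
    ultimately show "poly p z = poly (smult (coeff p n) q) z"
      using j p(2) by simp
  qed
  then have eq: "cos (real n * y) = coeff p n * (\<Prod>j=1..n. cos y - cos (s j))" for y
    using p(2)[of y] q by (metis poly_smult)
  have "coeff p n \<noteq> 0" using eq[of 0] by auto
  then show ?thesis
    using eq unfolding s_def by (intro exI[of _ "inverse (coeff p n)"]) (auto simp: field_simps)
qed

section \<open>Nodes and amplitude\<close>

text \<open>
  Jordan's inequality, from the concavity of the sine.
\<close>

lemma half_le_sin:
  assumes "0 \<le> x" "x \<le> pi / 2"
  shows "2 * x / pi \<le> sin x"
proof -
  have "convex_on {0..pi/2} (\<lambda>x. - sin x)"
  proof (rule f''_ge0_imp_convex[where f' = "\<lambda>x. - cos x" and f'' = "\<lambda>x. sin x"])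
    fix x :: real assume "x \<in> {0..pi/2}"
    then show "0 \<le> sin x" by (intro sin_ge_zero) auto
  qed (auto intro!: derivative_eq_intros)
  from convex_onD_Icc'[OF this, of x] assms have "- sin x \<le> (- 1 - 0) / (pi / 2 - 0) * (x - 0) + 0"
    by simp
  then show ?thesis by (simp add: field_simps)
qed

text \<open>
  No derivative of \<open>f\<close> is needed at a zero of \<open>g\<close>.
\<close>

lemma DERIV_mult_at_zero:
  fixes f g :: "real \<Rightarrow> real"
  assumes f: "isCont f a" and g: "(g has_real_derivative g') (at a)" and "g a = 0"
  shows "((\<lambda>x. f x * g x) has_real_derivative f a * g') (at a)"
proof -
  have "((\<lambda>x. f x * ((g x - g a) / (x - a))) \<longlongrightarrow> f a * g') (at a)"
    using f g unfolding has_field_derivative_iff isCont_def by (intro tendsto_mult)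
  then show ?thesis
    unfolding has_field_derivative_iff using \<open>g a = 0\<close> by simp
qed

lemma shifted_angle_zero:
  "shifted_angle n d k = shifted_angle n 0 k - d"
  by (simp add: shifted_angle_def)

lemma shifted_angle_bounds:
  assumes "n \<ge> 1" "k \<in> {1..n}"
  shows "pi / (2 * real n) \<le> shifted_angle n 0 k" "shifted_angle n 0 k \<le> pi - pi / (2 * real n)"
proof -
  have h: "pi / (2 * real n) \<ge> 0" by simp
  have e: "shifted_angle n 0 k = (2 * real k - 1) * (pi / (2 * real n))"
    by (simp add: shifted_angle_def)
  have "1 * (pi / (2 * real n)) \<le> (2 * real k - 1) * (pi / (2 * real n))"
    using assms h by (intro mult_right_mono) auto
  then show "pi / (2 * real n) \<le> shifted_angle n 0 k" unfolding e by simp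
  have "(2 * real k - 1) * (pi / (2 * real n)) \<le> (2 * real n - 1) * (pi / (2 * real n))"
    using assms h by (intro mult_right_mono) auto
  also have "(2 * real n - 1) * (pi / (2 * real n)) = pi - pi / (2 * real n)"
    using assms by (simp add: field_simps)
  finally show "shifted_angle n 0 k \<le> pi - pi / (2 * real n)" unfolding e .
qed

text \<open>
  The nodal product of the shifted nodes is \<open>amp n d t\<close> times that of the Chebyshev nodes taken
  at \<open>t + d\<close>; see \<open>node_prod_eq_amp\<close>. The function \<open>amp n d\<close> is a slowly varying amplitude that
  behaves like the power of \<open>tan (t / 2)\<close> with exponent \<open>2 n d / pi\<close>. It is positive on \<open>(0, pi)\<close> for
  \<open>0 \<le> d \<le> pi / (2 n)\<close>.
\<close>

definition amp :: "nat \<Rightarrow> real \<Rightarrow> real \<Rightarrow> real" where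
  "amp n d t = (\<Prod>j=1..n. sin ((shifted_angle n 0 j + t - d) / 2)
                        / sin ((shifted_angle n 0 j + t + d) / 2))"

lemma amp_arguments:
  assumes "n \<ge> 1" "0 \<le> d" "d \<le> pi / (2 * real n)" "0 < t" "t < pi" "j \<in> {1..n}"
  shows "sin ((shifted_angle n 0 j + t - d) / 2) > 0"
    and "sin ((shifted_angle n 0 j + t + d) / 2) > 0"
  using shifted_angle_bounds[of n j] assms by (intro sin_gt_zero; simp)+

lemma amp_pos:
  assumes "n \<ge> 1" "0 \<le> d" "d \<le> pi / (2 * real n)" "0 < t" "t < pi"
  shows "amp n d t > 0"
  unfolding amp_def using amp_arguments[OF assms] by (intro prod_pos) auto

lemma isCont_amp:
  assumes "n \<ge> 1" "0 \<le> d" "d \<le> pi / (2 * real n)" "0 < t" "t < pi"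
  shows "isCont (amp n d) t"
proof -
  have "amp n d = (\<lambda>t. \<Prod>j=1..n. sin ((shifted_angle n 0 j + t - d) / 2)
                        / sin ((shifted_angle n 0 j + t + d) / 2))"
    by (simp add: amp_def fun_eq_iff)
  moreover have "isCont \<dots> t"
    using amp_arguments(2)[OF assms] by (intro continuous_intros) fastforce+
  ultimately show ?thesis by simp
qed

lemma node_prod_eq_amp:
  assumes "n \<ge> 1" "0 \<le> d" "d \<le> pi / (2 * real n)" "0 < t" "t < pi"
  shows "(\<Prod>j=1..n. cos t - cos (shifted_angle n d j)) =
    amp n d t * (\<Prod>j=1..n. cos (t + d) - cos (shifted_angle n 0 j))"
  unfolding amp_def prod.distrib[symmetric]
proof (rule prod.cong[OF refl])
  fix j assume j: "j \<in> {1..n}"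
  define s where "s = shifted_angle n 0 j"
  have "sin ((s + t + d) / 2) \<noteq> 0"
    using amp_arguments(2)[OF assms j] by (simp add: s_def)
  moreover have "cos t - cos (s - d) = 2 * sin ((s + t - d) / 2) * sin ((s - t - d) / 2)"
    unfolding cos_diff_cos by (simp add: algebra_simps)
  moreover have "cos (t + d) - cos s = 2 * sin ((s + t + d) / 2) * sin ((s - t - d) / 2)"
    unfolding cos_diff_cos by (simp add: algebra_simps)
  ultimately show "cos t - cos (shifted_angle n d j) =
      sin ((shifted_angle n 0 j + t - d) / 2) / sin ((shifted_angle n 0 j + t + d) / 2)
      * (cos (t + d) - cos (shifted_angle n 0 j))"
    unfolding shifted_angle_zero[of n d] s_def[symmetric] by simp
qed

lemma abs_sin_node:
  assumes "n \<ge> 1"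
  shows "cos (real n * shifted_angle n 0 k) = 0" "\<bar>sin (real n * shifted_angle n 0 k)\<bar> = 1"
proof -
  have "real n * shifted_angle n 0 k = real k * pi - pi / 2"
    using assms by (simp add: shifted_angle_def field_simps)
  then show c: "cos (real n * shifted_angle n 0 k) = 0"
    by (simp add: cos_diff)
  show "\<bar>sin (real n * shifted_angle n 0 k)\<bar> = 1"
    using sin_cos_squared_add[of "real n * shifted_angle n 0 k"] c
    by (simp add: abs_square_eq_1)
qed

text \<open>
  Both the factorization of the nodal product at the node itself and its form
  \<open>amp n d t * c * cos (n (t + d))\<close> are differentiated at the node; comparing the two derivatives gives
  the denominator of the fundamental polynomial.
\<close>

lemma abs_lagrange_fund_eq_amp:
  assumes n: "n \<ge> 1" and d: "0 \<le> d" "d < pi / (2 * real n)" and k: "k \<in> {1..n}"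
    and t: "0 < t" "t < pi" and ne: "cos t \<noteq> cos (shifted_angle n d k)"
  shows "\<bar>lagrange_fund n (shifted_angle n d) k t\<bar> =
    \<bar>sin (real n * (t - shifted_angle n d k))\<bar> * sin (shifted_angle n d k)
      / (real n * \<bar>cos t - cos (shifted_angle n d k)\<bar>)
    * (amp n d t / amp n d (shifted_angle n d k))"
proof -
  define s where "s = shifted_angle n 0 k"
  define a where "a = shifted_angle n d k"
  have as: "a = s - d" by (simp add: a_def s_def shifted_angle_zero[of n d])
  have d': "d \<in> {- (pi / (2 * real n))<..<pi / (2 * real n)}"
  proof -
    have "pi / (2 * real n) > 0" using n by simp
    then show ?thesis using d by simp
  qed
  have a: "0 < a" "a < pi"
    using shifted_angle_in[OF n d' k] by (auto simp: a_def)
  have inj: "inj_on (\<lambda>j. cos (shifted_angle n d j)) {1..n}"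
    using inj_on_cos_shifted_angle[OF n d'] .
  obtain c where c: "c \<noteq> 0"
    "\<And>y. (\<Prod>j=1..n. cos y - cos (shifted_angle n 0 j)) = c * cos (real n * y)"
    using cos_multiple_eq_prod[OF n] by metis
  define G where "G y = (\<Prod>j\<in>{1..n} - {k}. cos y - cos (shifted_angle n d j))" for y
  have N: "G y * (cos y - cos a) = amp n d y * (c * cos (real n * (y + d)))" if "0 < y" "y < pi" for y
  proof -
    have "G y * (cos y - cos a) = (\<Prod>j=1..n. cos y - cos (shifted_angle n d j))"
      unfolding G_def a_def using k by (subst (2) prod.remove[of _ k]) (auto simp: mult.commute)
    also have "\<dots> = amp n d y * (c * cos (real n * (y + d)))"
      using node_prod_eq_amp[of n d y] n d that c by simp
    finally show ?thesis .
  qed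
  have sn: "cos (real n * s) = 0" "\<bar>sin (real n * s)\<bar> = 1"
    unfolding s_def using abs_sin_node[OF n] by auto
  have "((\<lambda>y. G y * (cos y - cos a)) has_real_derivative G a * (- sin a)) (at a)"
    by (rule DERIV_mult_at_zero)
      (auto simp: G_def[abs_def] intro!: continuous_intros derivative_eq_intros)
  moreover have "((\<lambda>y. amp n d y * (c * cos (real n * (y + d)))) has_real_derivative
      amp n d a * (- c * (real n * sin (real n * s)))) (at a)"
  proof (rule DERIV_mult_at_zero)
    show "isCont (amp n d) a" using isCont_amp n d a by simp
    show "((\<lambda>y. c * cos (real n * (y + d))) has_real_derivative - c * (real n * sin (real n * s))) (at a)"
      by (auto intro!: derivative_eq_intros simp: as)
    show "c * cos (real n * (a + d)) = 0" using sn as by simp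
  qed
  then have "((\<lambda>y. G y * (cos y - cos a)) has_real_derivative
      amp n d a * (- c * (real n * sin (real n * s)))) (at a)"
    by (rule has_field_derivative_transform_within_open[where S = "{0<..<pi}"])
      (use a N in auto)
  ultimately have "G a * (- sin a) = amp n d a * (- c * (real n * sin (real n * s)))"
    by (rule DERIV_unique)
  then have "\<bar>G a * sin a\<bar> = \<bar>amp n d a * (c * (real n * sin (real n * s)))\<bar>"
    by simp
  then have Ga: "\<bar>G a\<bar> * sin a = amp n d a * \<bar>c\<bar> * real n"
    using sin_gt_zero[OF a] amp_pos[of n d a] n d a sn by (simp add: abs_mult)
  have "\<bar>G t\<bar> * \<bar>cos t - cos a\<bar> = amp n d t * \<bar>c\<bar> * \<bar>cos (real n * (t + d))\<bar>"
    using arg_cong[OF N[OF t], of abs] amp_pos[of n d t] n d t by (simp add: abs_mult)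
  moreover have "\<bar>cos (real n * (t + d))\<bar> = \<bar>sin (real n * (t - a))\<bar>"
  proof -
    have "real n * (t + d) = real n * (t - a) + real n * s"
      by (simp add: as algebra_simps)
    then show ?thesis using sn by (simp add: cos_add abs_mult)
  qed
  ultimately have Gt: "\<bar>G t\<bar> * \<bar>cos t - cos a\<bar> = amp n d t * \<bar>c\<bar> * \<bar>sin (real n * (t - a))\<bar>"
    by simp
  have "\<bar>lagrange_fund n (shifted_angle n d) k t\<bar> = \<bar>G t\<bar> / \<bar>G a\<bar>"
    unfolding lagrange_fund_eq_prod[OF inj k] G_def a_def by (simp add: prod_dividef)
  also have "\<bar>G t\<bar> = amp n d t * \<bar>c\<bar> * \<bar>sin (real n * (t - a))\<bar> / \<bar>cos t - cos a\<bar>"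
    using Gt ne by (simp add: field_simps a_def)
  also have "\<bar>G a\<bar> = amp n d a * \<bar>c\<bar> * real n / sin a"
    using Ga sin_gt_zero[OF a] by (simp add: field_simps)
  also have "amp n d t * \<bar>c\<bar> * \<bar>sin (real n * (t - a))\<bar> / \<bar>cos t - cos a\<bar> / (amp n d a * \<bar>c\<bar> * real n / sin a)
     = \<bar>sin (real n * (t - a))\<bar> * sin a / (real n * \<bar>cos t - cos a\<bar>) * (amp n d t / amp n d a)"
    using c by (simp add: field_simps)
  finally show ?thesis by (simp add: a_def)
qed

text \<open>
  Each factor of the amplitude is increasing.
\<close>

lemma amp_mono:
  assumes "n \<ge> 1" "0 \<le> d" "d \<le> pi / (2 * real n)" "0 < a" "a \<le> b" "b < pi"
  shows "amp n d a \<le> amp n d b"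
  unfolding amp_def
proof (rule prod_mono)
  fix j assume j: "j \<in> {1..n}"
  define A where "A = (shifted_angle n 0 j + a) / 2"
  define B where "B = (shifted_angle n 0 j + b) / 2"
  define e where "e = d / 2"
  have pos: "sin (A - e) > 0" "sin (A + e) > 0" "sin (B - e) > 0" "sin (B + e) > 0"
    using amp_arguments[of n d a j] amp_arguments[of n d b j] assms j
    by (simp_all add: A_def B_def e_def add_divide_distrib diff_divide_distrib)
  have "sin (B - e) * sin (A + e) - sin (A - e) * sin (B + e) = sin (B - A) * sin (2 * e)"
    unfolding sin_times_sin using cos_minus[of "B + e * 2 - A"] by (simp add: field_simps)
  moreover have "sin (B - A) * sin (2 * e) \<ge> 0"
  proof (intro mult_nonneg_nonneg sin_ge_zero)
    have "pi / (2 * real n) \<le> pi / 2" using assms by (intro divide_left_mono) auto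
    then show "2 * e \<le> pi" using assms by (simp add: e_def)
    show "B - A \<le> pi" using assms by (simp add: A_def B_def field_simps)
  qed (use assms in \<open>auto simp: A_def B_def e_def\<close>)
  ultimately have "sin (A - e) / sin (A + e) \<le> sin (B - e) / sin (B + e)"
    using pos by (simp add: field_simps)
  then show "0 \<le> sin ((shifted_angle n 0 j + a - d) / 2) / sin ((shifted_angle n 0 j + a + d) / 2) \<and>
    sin ((shifted_angle n 0 j + a - d) / 2) / sin ((shifted_angle n 0 j + a + d) / 2)
    \<le> sin ((shifted_angle n 0 j + b - d) / 2) / sin ((shifted_angle n 0 j + b + d) / 2)"
    using pos by (simp add: A_def B_def e_def add_divide_distrib diff_divide_distrib)
qed

text \<open>
  For the largest shift, half the mesh width, the product telescopes.
\<close>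

lemma amp_half_step:
  assumes "n \<ge> 1" "0 < t" "t < pi"
  shows "amp n (pi / (2 * real n)) t = tan (t / 2)"
proof -
  define g where "g j = sin (real j * pi / (2 * real n) + t / 2)" for j :: nat
  have half: "s - h = 2 * u \<Longrightarrow> (s + t - h) / 2 = u + t / 2" "s + h = 2 * u \<Longrightarrow> (s + t + h) / 2 = u + t / 2"
    for s h u :: real by simp_all
  have "amp n (pi / (2 * real n)) t = (\<Prod>j=1..n. g (j - 1) / g j)"
    unfolding amp_def
  proof (rule prod.cong[OF refl])
    fix j assume "j \<in> {1..n}"
    then have "shifted_angle n 0 j - pi / (2 * real n) = 2 * (real (j - 1) * pi / (2 * real n))"
      "shifted_angle n 0 j + pi / (2 * real n) = 2 * (real j * pi / (2 * real n))"
      using assms by (simp_all add: shifted_angle_def field_simps of_nat_diff)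
    then have "(shifted_angle n 0 j + t - pi / (2 * real n)) / 2 = real (j - 1) * pi / (2 * real n) + t / 2"
      "(shifted_angle n 0 j + t + pi / (2 * real n)) / 2 = real j * pi / (2 * real n) + t / 2"
      using half by blast+
    then show "sin ((shifted_angle n 0 j + t - pi / (2 * real n)) / 2) /
        sin ((shifted_angle n 0 j + t + pi / (2 * real n)) / 2) = g (j - 1) / g j"
      by (simp only: g_def)
  qed
  also have "\<dots> = g 0 / g n"
  proof -
    have pos: "g j > 0" if "j \<le> n" for j
    proof -
      have "real j * pi / (2 * real n) \<le> pi / 2"
        using that assms by (simp add: field_simps)
      moreover have "real j * pi / (2 * real n) \<ge> 0" by simp
      ultimately show ?thesis unfolding g_def using assms by (intro sin_gt_zero) linarith+
    qed
    have "(\<Prod>j=1..m. g (j - 1) / g j) = g 0 / g m" if "m \<le> n" for m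
      using that
    proof (induction m)
      case 0
      then show ?case using pos[of 0] by simp
    next
      case (Suc m)
      then show ?case using pos[of m] by simp
    qed
    then show ?thesis by simp
  qed
  also have "\<dots> = tan (t / 2)"
    using assms by (simp add: g_def tan_def sin_add)
  finally show ?thesis .
qed

text \<open>
  The ratio of two values of the amplitude increases with the shift, factor by factor, so it is
  bounded by its value at the largest shift.
\<close>

lemma amp_ratio_le:
  assumes "n \<ge> 1" "0 \<le> d" "d \<le> pi / (2 * real n)" "0 < a" "a \<le> b" "b < pi"
  shows "amp n d b / amp n d a \<le> tan (b / 2) / tan (a / 2)"
proof -
  define h where "h = pi / (2 * real n)"
  have h: "0 \<le> h" "h \<le> pi / (2 * real n)" by (auto simp: h_def)
  have "amp n d b * amp n h a \<le> amp n h b * amp n d a"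
    unfolding amp_def prod.distrib[symmetric]
  proof (rule prod_mono)
    fix j assume j: "j \<in> {1..n}"
    define A where "A = (shifted_angle n 0 j + a) / 2"
    define B where "B = (shifted_angle n 0 j + b) / 2"
    define e where "e = d / 2"
    define f where "f = h / 2"
    have pos: "sin (A - e) > 0" "sin (A + e) > 0" "sin (B - e) > 0" "sin (B + e) > 0"
      using amp_arguments[of n d a j] amp_arguments[of n d b j] assms j
      by (simp_all add: A_def B_def e_def add_divide_distrib diff_divide_distrib)
    have pos': "sin (A - f) > 0" "sin (A + f) > 0" "sin (B - f) > 0" "sin (B + f) > 0"
      using amp_arguments[of n h a j] amp_arguments[of n h b j] assms j h
      by (simp_all add: A_def B_def f_def add_divide_distrib diff_divide_distrib)
    have "sin (B - A) * sin (f - e) \<ge> 0"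
    proof (intro mult_nonneg_nonneg sin_ge_zero)
      have "pi / (2 * real n) \<le> pi / 2" using assms by (intro divide_left_mono) auto
      then show "f - e \<le> pi" using assms by (simp add: e_def f_def h_def)
      show "B - A \<le> pi" using assms by (simp add: A_def B_def field_simps)
    qed (use assms in \<open>auto simp: A_def B_def e_def f_def h_def\<close>)
    moreover have "sin (A - e) * sin (B - f) - sin (B - e) * sin (A - f) = sin (B - A) * sin (f - e)"
      "sin (A + f) * sin (B + e) - sin (A + e) * sin (B + f) = sin (B - A) * sin (f - e)"
      unfolding sin_times_sin
      using cos_minus[of "B + e - (A + f)"] cos_minus[of "B + f - (A + e)"]
      by (simp_all add: field_simps)
    ultimately have "sin (B - e) * sin (A - f) \<le> sin (A - e) * sin (B - f)"
      "sin (A + e) * sin (B + f) \<le> sin (A + f) * sin (B + e)" by linarith+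
    then have "(sin (B - e) * sin (A - f)) * (sin (A + e) * sin (B + f))
        \<le> (sin (A - e) * sin (B - f)) * (sin (A + f) * sin (B + e))"
      by (rule mult_mono) (use pos pos' in auto)
    then have "sin (B - e) / sin (B + e) * (sin (A - f) / sin (A + f))
        \<le> sin (B - f) / sin (B + f) * (sin (A - e) / sin (A + e))"
      using pos pos' by (simp add: field_simps)
    then show "0 \<le> sin ((shifted_angle n 0 j + b - d) / 2) / sin ((shifted_angle n 0 j + b + d) / 2) *
        (sin ((shifted_angle n 0 j + a - h) / 2) / sin ((shifted_angle n 0 j + a + h) / 2)) \<and>
      sin ((shifted_angle n 0 j + b - d) / 2) / sin ((shifted_angle n 0 j + b + d) / 2) *
        (sin ((shifted_angle n 0 j + a - h) / 2) / sin ((shifted_angle n 0 j + a + h) / 2))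
      \<le> sin ((shifted_angle n 0 j + b - h) / 2) / sin ((shifted_angle n 0 j + b + h) / 2) *
        (sin ((shifted_angle n 0 j + a - d) / 2) / sin ((shifted_angle n 0 j + a + d) / 2))"
      using pos pos' by (simp add: A_def B_def e_def f_def add_divide_distrib diff_divide_distrib)
  qed
  moreover have "amp n h a = tan (a / 2)" "amp n h b = tan (b / 2)"
    using amp_half_step assms by (auto simp: h_def)
  moreover have "amp n d a > 0" "tan (a / 2) > 0"
    using amp_pos[of n d a] assms by (auto intro!: tan_gt_zero)
  ultimately show ?thesis by (simp add: field_simps)
qed

section \<open>Uniform bound for the fundamental polynomials\<close>

lemma abs_sin_multiple_le:
  "\<bar>sin (real n * x)\<bar> \<le> real n * \<bar>sin x\<bar>"
proof (induction n)
  case (Suc n)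
  have "\<bar>sin (real (Suc n) * x)\<bar> = \<bar>sin (real n * x) * cos x + cos (real n * x) * sin x\<bar>"
    by (simp add: sin_add algebra_simps)
  also have "\<dots> \<le> \<bar>sin (real n * x)\<bar> * \<bar>cos x\<bar> + \<bar>cos (real n * x)\<bar> * \<bar>sin x\<bar>"
    by (metis abs_mult abs_triangle_ineq)
  also have "\<dots> \<le> \<bar>sin (real n * x)\<bar> * 1 + 1 * \<bar>sin x\<bar>"
    by (intro add_mono mult_mono) auto
  also have "\<dots> \<le> real (Suc n) * \<bar>sin x\<bar>"
    using Suc by (simp add: distrib_right)
  finally show ?case .
qed simp

text \<open>
  To the left of the node the amplitude only helps, and the estimate is the one for Chebyshev nodes.
  To the right of the node the amplitude ratio is replaced by the ratio of tangents; the factor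
  \<open>1 / sin ((pi - t) / 2)\<close> that this produces is at most \<open>2 n\<close>, since the distance of \<open>t\<close>
  from \<open>pi\<close> is at least \<open>pi / (2 n)\<close>.
\<close>

lemma abs_lagrange_fund_le_nonneg_shift:
  assumes n: "n \<ge> 1" and d: "0 \<le> d" "d < pi / (2 * real n)" and k: "k \<in> {1..n}"
    and t: "pi / (2 * real n) \<le> t" "t \<le> pi - pi / (2 * real n)"
  shows "\<bar>lagrange_fund n (shifted_angle n d) k t\<bar> \<le> 4"
proof (cases "cos t = cos (shifted_angle n d k)")
  case True
  then show ?thesis by (simp add: lagrange_fund_def)
next
  case False
  define a where "a = shifted_angle n d k"
  define S where "S = \<bar>sin (real n * (t - a))\<bar>"
  define r where "r = amp n d t / amp n d a"
  have h: "pi / (2 * real n) > 0" using n by simp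
  have t': "0 < t" "t < pi" using t h by linarith+
  have "d \<in> {- (pi / (2 * real n))<..<pi / (2 * real n)}"
    using h d by simp
  then have a: "0 < a" "a < pi"
    using shifted_angle_in[OF n _ k] by (auto simp: a_def)
  have l: "\<bar>lagrange_fund n (shifted_angle n d) k t\<bar>
      = S * sin a / (real n * \<bar>cos t - cos a\<bar>) * r"
    using abs_lagrange_fund_eq_amp[OF n d k t' False] by (simp add: a_def S_def r_def)
  have n0: "real n > 0" using n by simp
  have S: "0 \<le> S" "S \<le> 1" by (auto simp: S_def)
  have S2: "S \<le> 2 * real n * \<bar>sin ((t - a) / 2)\<bar>"
    using abs_sin_multiple_le[of "2 * n" "(t - a) / 2"] by (simp add: S_def)
  have dc: "\<bar>cos t - cos a\<bar> = 2 * sin ((t + a) / 2) * \<bar>sin ((t - a) / 2)\<bar>"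
  proof -
    have "sin ((t + a) / 2) \<ge> 0" using a t' by (intro sin_ge_zero) auto
    moreover have "\<bar>sin ((a - t) / 2)\<bar> = \<bar>sin ((t - a) / 2)\<bar>"
      by (metis abs_minus_cancel minus_diff_eq minus_divide_left sin_minus)
    ultimately show ?thesis unfolding cos_diff_cos by (simp add: abs_mult)
  qed
  have sa: "sin a > 0" using a by (rule sin_gt_zero)
  have sta: "sin ((t + a) / 2) > 0" using a t' by (intro sin_gt_zero) auto
  have tna: "t \<noteq> a" using False by (auto simp: a_def)
  then have sd: "\<bar>sin ((t - a) / 2)\<bar> > 0"
    using False dc sta by (auto simp: a_def)
  show ?thesis
  proof (cases "t < a")
    case True
    have "r \<le> 1"
      using amp_mono[of n d t a] amp_pos[of n d a] True n d a t' by (simp add: r_def)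
    moreover have "S * sin a / (real n * \<bar>cos t - cos a\<bar>) \<le> 2"
    proof -
      have "sin a \<le> sin t + sin a" using t' by (simp add: sin_ge_zero)
      also have "\<dots> = 2 * sin ((t + a) / 2) * cos ((t - a) / 2)" by (rule sin_plus_sin)
      also have "\<dots> \<le> 2 * sin ((t + a) / 2) * 1" using sta by (intro mult_left_mono) auto
      finally have "S * sin a \<le> (2 * real n * \<bar>sin ((t - a) / 2)\<bar>) * (2 * sin ((t + a) / 2))"
        using S S2 sa by (intro mult_mono) auto
      also have "\<dots> = 2 * (real n * \<bar>cos t - cos a\<bar>)" by (simp add: dc)
      finally show ?thesis using n0 sd sta dc by (simp add: divide_le_eq)
    qed
    moreover have "0 \<le> r"
      using amp_pos[of n d a] amp_pos[of n d t] n d a t' by (simp add: r_def)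
    moreover have "0 \<le> S * sin a / (real n * \<bar>cos t - cos a\<bar>)" using S sa by simp
    ultimately have "S * sin a / (real n * \<bar>cos t - cos a\<bar>) * r \<le> 2 * 1"
      by (intro mult_mono) auto
    then show ?thesis using l by linarith
  next
    case False
    then have at: "a < t" using tna by linarith
    define u where "u = (pi - t) / 2"
    define v where "v = (pi - a) / 2"
    have uv: "0 < u" "u < v" "v < pi / 2" using at a t' by (auto simp: u_def v_def)
    have ta: "t / 2 = pi / 2 - u" "a / 2 = pi / 2 - v" "(t - a) / 2 = v - u" "(t + a) / 2 = pi - (u + v)"
      "a = 2 * (pi / 2 - v)" by (auto simp: u_def v_def field_simps)
    have pos: "sin u > 0" "sin v > 0" "cos u > 0" "cos v > 0" "sin (v - u) > 0" "sin (u + v) > 0"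
      using uv by (auto intro!: sin_gt_zero cos_gt_zero)
    have tans: "tan (t / 2) = cos u / sin u" "tan (a / 2) = cos v / sin v"
      unfolding ta(1,2) tan_def by (simp_all add: sin_diff cos_diff)
    have sina: "sin a = 2 * cos v * sin v"
      by (subst ta(5), subst sin_double) (simp add: sin_diff cos_diff)
    have D: "\<bar>cos t - cos a\<bar> = 2 * sin (u + v) * sin (v - u)"
      unfolding dc ta(3,4) using pos by simp
    have "S * sin v \<le> S * (sin (v - u) + sin u)"
    proof (rule mult_left_mono)
      have "sin v = sin ((v - u) + u)" by simp
      also have "\<dots> = sin (v - u) * cos u + cos (v - u) * sin u" by (rule sin_add)
      also have "\<dots> \<le> sin (v - u) * 1 + 1 * sin u"
        using pos by (intro add_mono mult_left_mono mult_right_mono) auto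
      finally show "sin v \<le> sin (v - u) + sin u" by simp
    qed (use S in simp)
    also have "\<dots> = S * sin (v - u) + S * sin u" by (rule distrib_left)
    also have "\<dots> \<le> 2 * real n * sin u * sin (v - u) + 2 * real n * sin (v - u) * sin u"
    proof (rule add_mono)
      \<comment> \<open>\<open>u \<ge> pi / (4 n)\<close>, by the distance of \<open>t\<close> from \<open>pi\<close>\<close>
      have "2 * (pi / (4 * real n)) / pi \<le> 2 * u / pi"
        using t by (intro divide_right_mono) (auto simp: u_def field_simps)
      also have "\<dots> \<le> sin u" using uv by (intro half_le_sin) auto
      finally have "1 \<le> 2 * real n * sin u" using n0 by (simp add: field_simps)
      then show "S * sin (v - u) \<le> 2 * real n * sin u * sin (v - u)"
        using S pos by (intro mult_right_mono) auto
      show "S * sin u \<le> 2 * real n * sin (v - u) * sin u"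
        using S2 pos unfolding ta(3) by (intro mult_right_mono) auto
    qed
    finally have key: "S * sin v \<le> 4 * real n * sin u * sin (v - u)" by simp
    have suv: "sin v * cos u \<le> sin (u + v)"
      using pos by (simp add: sin_add mult.commute)
    have "r \<le> tan (t / 2) / tan (a / 2)"
      unfolding r_def using amp_ratio_le[of n d a t] at n d a t' by simp
    then have "S * sin a / (real n * \<bar>cos t - cos a\<bar>) * r
        \<le> S * sin a / (real n * \<bar>cos t - cos a\<bar>) * (tan (t / 2) / tan (a / 2))"
      using S sa by (intro mult_left_mono) auto
    also have "\<dots> = (S * sin v) * (sin v * cos u) / (real n * sin (u + v) * sin (v - u) * sin u)"
      unfolding tans sina D using pos by (simp add: field_simps)
    also have "\<dots> \<le> (4 * real n * sin u * sin (v - u)) * sin (u + v)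
        / (real n * sin (u + v) * sin (v - u) * sin u)"
      using key S pos n0 by (intro divide_right_mono mult_mono[OF key suv]) auto
    also have "\<dots> = 4" using pos n0 by (simp add: field_simps)
    finally show ?thesis using l by linarith
  qed
qed

text \<open>
  The reflection \<open>t \<mapsto> pi - t\<close> reverses the sign of the shift.
\<close>

lemma lagrange_fund_reflect:
  assumes n: "n \<ge> 1" and d: "d \<in> {- (pi / (2 * real n))<..<pi / (2 * real n)}" and k: "k \<in> {1..n}"
  shows "lagrange_fund n (shifted_angle n d) k t
    = lagrange_fund n (shifted_angle n (- d)) (n + 1 - k) (pi - t)"
proof -
  have d': "- d \<in> {- (pi / (2 * real n))<..<pi / (2 * real n)}" using d by auto
  have k': "n + 1 - k \<in> {1..n}" using k by auto
  have c: "cos (shifted_angle n (- d) (n + 1 - j)) = - cos (shifted_angle n d j)" if "j \<in> {1..n}" for j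
  proof -
    have "shifted_angle n (- d) (n + 1 - j) = pi - shifted_angle n d j"
      using that n by (simp add: shifted_angle_def of_nat_diff field_simps)
    then show ?thesis by (simp add: cos_diff)
  qed
  have "(\<Prod>j\<in>{1..n} - {n + 1 - k}. (cos (pi - t) - cos (shifted_angle n (- d) j))
      / (cos (shifted_angle n (- d) (n + 1 - k)) - cos (shifted_angle n (- d) j)))
    = (\<Prod>j\<in>{1..n} - {k}. (cos t - cos (shifted_angle n d j))
      / (cos (shifted_angle n d k) - cos (shifted_angle n d j)))"
  proof (rule prod.reindex_bij_witness[of _ "\<lambda>j. n + 1 - j" "\<lambda>j. n + 1 - j"])
    fix j assume "j \<in> {1..n} - {n + 1 - k}"
    then have j: "n + 1 - j \<in> {1..n}" "n + 1 - (n + 1 - j) = j" by auto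
    have "(cos t - cos (shifted_angle n d i)) / (cos (shifted_angle n d k) - cos (shifted_angle n d i))
      = (- cos t + cos (shifted_angle n d i)) / (- cos (shifted_angle n d k) + cos (shifted_angle n d i))" for i
      using minus_divide_divide[of "cos t - cos (shifted_angle n d i)"
          "cos (shifted_angle n d k) - cos (shifted_angle n d i)"]
      by (simp add: minus_diff_eq)
    then show "(cos t - cos (shifted_angle n d (n + 1 - j)))
        / (cos (shifted_angle n d k) - cos (shifted_angle n d (n + 1 - j)))
      = (cos (pi - t) - cos (shifted_angle n (- d) j))
        / (cos (shifted_angle n (- d) (n + 1 - k)) - cos (shifted_angle n (- d) j))"
      using c[OF j(1)] c[OF k] unfolding j(2) by (simp add: cos_diff)
  qed (use k in auto)
  then show ?thesis
    using lagrange_fund_eq_prod[OF inj_on_cos_shifted_angle[OF n d] k]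
      lagrange_fund_eq_prod[OF inj_on_cos_shifted_angle[OF n d'] k'] by simp
qed

lemma abs_lagrange_fund_le:
  assumes n: "n \<ge> 1" and d: "d \<in> {- (pi / (2 * real n))<..<pi / (2 * real n)}" and k: "k \<in> {1..n}"
    and t: "pi / (2 * real n) \<le> t" "t \<le> pi - pi / (2 * real n)"
  shows "\<bar>lagrange_fund n (shifted_angle n d) k t\<bar> \<le> 4"
proof (cases "d \<ge> 0")
  case True
  then show ?thesis using abs_lagrange_fund_le_nonneg_shift n d k t by auto
next
  case False
  then show ?thesis
    unfolding lagrange_fund_reflect[OF n d k]
    using d k t by (intro abs_lagrange_fund_le_nonneg_shift[OF n]) auto
qed

section \<open>The tail of the series of cosines over squares\<close>

lemma two_sin_half_times_cos:
  "2 * sin (x / 2) * cos (real (Suc k) * x) = sin ((real (Suc k) + 1 / 2) * x) - sin ((real k + 1 / 2) * x)"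
proof -
  have "2 * sin (x / 2) * cos (real (Suc k) * x) =
      sin (x / 2 + real (Suc k) * x) + sin (x / 2 - real (Suc k) * x)"
    by (simp add: mult.assoc sin_times_cos del: of_nat_Suc)
  moreover have "x / 2 + real (Suc k) * x = (real (Suc k) + 1 / 2) * x"
    "x / 2 - real (Suc k) * x = - ((real k + 1 / 2) * x)"
    by (simp_all add: algebra_simps)
  ultimately show ?thesis by (simp only: sin_minus)
qed

lemma dirichlet_kernel:
  "2 * sin (x / 2) * (1 / 2 + (\<Sum>k=1..m. cos (real k * x))) = sin ((real m + 1 / 2) * x)"
proof (induction m)
  case (Suc m)
  then show ?case
    using two_sin_half_times_cos[of x m] by (simp add: distrib_left)
qed simp

text \<open>
  Summation by parts with the sines \<open>s k = sin ((k + 1/2) x)\<close>, whose differences are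
  \<open>2 sin (x / 2) cos (k x)\<close>.
\<close>

lemma abel_cos_sum_bound:
  fixes a :: "nat \<Rightarrow> real"
  assumes dec: "\<And>k. a (Suc k) \<le> a k" and nonneg: "\<And>k. 0 \<le> a k"
  shows "\<bar>sin (x / 2) * (\<Sum>k=Suc m..<M. a k * cos (real k * x))\<bar> \<le> a (Suc m)"
proof (cases "Suc m < M")
  case True
  define s where "s k = sin ((real k + 1 / 2) * x)" for k :: nat
  have s: "\<bar>s k\<bar> \<le> 1" for k by (simp add: s_def)
  have "\<bar>(\<Sum>k=Suc m..<M. a k * (s k - s (k - 1))) - a (M - 1) * s (M - 1)\<bar> \<le> 2 * a (Suc m) - a (M - 1)"
    using Suc_leI[OF True]
  proof (induction M rule: dec_induct)
    case base
    have "\<bar>- (a (Suc m) * s m)\<bar> \<le> a (Suc m) * 1"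
      unfolding abs_minus_cancel abs_mult using s[of m] nonneg[of "Suc m"] by (intro mult_mono) auto
    then show ?case by (simp add: algebra_simps)
  next
    case (step N)
    obtain K where K: "N = Suc K" using step by (cases N) auto
    have "\<bar>(a K - a N) * s K\<bar> \<le> (a K - a N) * 1"
      unfolding abs_mult using s[of K] dec[of K] K by (intro mult_mono) auto
    moreover have "(\<Sum>k=Suc m..<Suc N. a k * (s k - s (k - 1))) - a (Suc N - 1) * s (Suc N - 1)
      = ((\<Sum>k=Suc m..<N. a k * (s k - s (k - 1))) - a (N - 1) * s (N - 1)) + (a K - a N) * s K"
      using step K by (simp add: algebra_simps)
    ultimately show ?case
      using step.IH abs_triangle_ineq[of "(\<Sum>k=Suc m..<N. a k * (s k - s (k - 1))) - a (N - 1) * s (N - 1)"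
          "(a K - a N) * s K"] K by simp
  qed
  moreover have "\<bar>a (M - 1) * s (M - 1)\<bar> \<le> a (M - 1) * 1"
    unfolding abs_mult using s[of "M - 1"] nonneg[of "M - 1"] by (intro mult_mono) auto
  ultimately have "\<bar>\<Sum>k=Suc m..<M. a k * (s k - s (k - 1))\<bar> \<le> 2 * a (Suc m)" by linarith
  moreover have "(\<Sum>k=Suc m..<M. a k * (s k - s (k - 1))) =
      2 * (sin (x / 2) * (\<Sum>k=Suc m..<M. a k * cos (real k * x)))"
    unfolding sum_distrib_left
  proof (rule sum.cong[OF refl])
    fix k assume "k \<in> {Suc m..<M}"
    then obtain j where "k = Suc j" by (cases k) auto
    then show "a k * (s k - s (k - 1)) = 2 * (sin (x / 2) * (a k * cos (real k * x)))"
      using two_sin_half_times_cos[of x j] by (simp add: s_def)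
  qed
  ultimately show ?thesis by (simp add: abs_mult)
qed (use nonneg in auto)

text \<open>
  On \<open>[0, 2 pi]\<close> the series of \<open>cos (k x) / k^2\<close> over \<open>k \<ge> 1\<close> differs from \<open>x^2 / 4 - pi x / 2\<close> by a
  constant. The function below is the remainder after \<open>m\<close> terms, with all functions normalized to
  vanish at \<open>pi\<close> so that the constant does not appear. It is written with the quadratic polynomial,
  hence it is meaningful as a remainder for \<open>0 \<le> x \<le> 2 pi\<close> only.
\<close>

definition sq_series_rem :: "nat \<Rightarrow> real \<Rightarrow> real" where
  "sq_series_rem m x = (x\<^sup>2 / 4 - pi * x / 2) - (pi\<^sup>2 / 4 - pi * pi / 2)
     - (\<Sum>k=1..m. (cos (real k * x) - cos (real k * pi)) / (real k)\<^sup>2)"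

lemma sq_series_rem_pi [simp]: "sq_series_rem m pi = 0"
  by (simp add: sq_series_rem_def)

lemma sq_series_rem_reflect: "sq_series_rem m (2 * pi - x) = sq_series_rem m x"
proof -
  have "cos (real k * (2 * pi - x)) = cos (real k * x)" for k
  proof -
    have "real k * (2 * pi - x) = - (real k * x) + 2 * pi * real k" by (simp add: algebra_simps)
    moreover have "cos (2 * pi * real k) = 1" "sin (2 * pi * real k) = 0"
      by (metis cos_2npi mult.assoc mult.commute) (metis sin_2npi mult.assoc mult.commute)
    ultimately show ?thesis by (simp add: cos_add cos_diff)
  qed
  moreover have "(2 * pi - x)\<^sup>2 / 4 - pi * (2 * pi - x) / 2 = x\<^sup>2 / 4 - pi * x / 2"
    by (simp add: power2_eq_square field_simps)
  ultimately show ?thesis by (simp only: sq_series_rem_def)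
qed

lemma DERIV_sq_series_rem:
  "(sq_series_rem m has_real_derivative (x - pi) / 2 + (\<Sum>k=1..m. sin (real k * x) / real k)) (at x)"
proof -
  have "((\<lambda>x. (x\<^sup>2 / 4 - pi * x / 2) - (pi\<^sup>2 / 4 - pi * pi / 2)
     - (\<Sum>k=1..m. (cos (real k * x) - cos (real k * pi)) / (real k)\<^sup>2)) has_real_derivative
     (x / 2 - pi / 2) - 0 - (\<Sum>k=1..m. - sin (real k * x) / real k)) (at x)"
  proof (intro DERIV_diff DERIV_sum)
    fix k assume "k \<in> {1..m}"
    then show "((\<lambda>x. (cos (real k * x) - cos (real k * pi)) / (real k)\<^sup>2) has_real_derivative
        - sin (real k * x) / real k) (at x)"
      by (auto intro!: derivative_eq_intros simp: power2_eq_square)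
  qed (auto intro!: derivative_eq_intros)
  then show ?thesis
    by (simp add: sq_series_rem_def[abs_def] sum_negf diff_divide_distrib)
qed

text \<open>
  The left-hand side is the derivative of the remainder, and its own derivative is half the Dirichlet
  kernel. Adding \<open>cos ((m + 1/2) x) W x\<close>, where \<open>W x = 1 / ((2 m + 1) sin (x / 2))\<close>, leaves a
  function whose derivative is dominated by that of the monotone function \<open>W\<close>.
\<close>

lemma abs_sawtooth_rem_le:
  assumes x: "0 < x" "x \<le> pi"
  shows "\<bar>(x - pi) / 2 + (\<Sum>k=1..m. sin (real k * x) / real k)\<bar> \<le> 2 / ((2 * real m + 1) * sin (x / 2))"
proof -
  define T where "T x = (x - pi) / 2 + (\<Sum>k=1..m. sin (real k * x) / real k)" for x
  define c where "c = 1 / (2 * real m + 1)"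
  define W where "W x = c * inverse (sin (x / 2))" for x
  \<comment> \<open>the leading oscillation of \<open>T\<close> is removed, so that \<open>V'\<close> has no Dirichlet kernel\<close>
  define V where "V x = T x + cos ((real m + 1 / 2) * x) * W x" for x
  define W' where "W' x = c * - (inverse (sin (x / 2)) * (cos (x / 2) / 2) * inverse (sin (x / 2)))" for x
  have c: "c > 0" "c * (real m + 1 / 2) = 1 / 2" by (simp_all add: c_def field_simps)
  have s: "sin (y / 2) > 0" if "0 < y" "y \<le> pi" for y
    using that by (intro sin_gt_zero) auto
  have dT: "(T has_real_derivative 1 / 2 + (\<Sum>k=1..m. cos (real k * y))) (at y)" for y
  proof -
    have "((\<lambda>x. (x - pi) / 2 + (\<Sum>k=1..m. sin (real k * x) / real k)) has_real_derivative
      1 / 2 + (\<Sum>k=1..m. cos (real k * y))) (at y)"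
      by (intro DERIV_add DERIV_sum) (auto intro!: derivative_eq_intros)
    then show ?thesis by (simp add: T_def[abs_def])
  qed
  have dW: "(W has_real_derivative W' y) (at y)" if "0 < y" "y \<le> pi" for y
  proof -
    have "((\<lambda>x. sin (x / 2)) has_real_derivative cos (y / 2) / 2) (at y)"
      by (auto intro!: derivative_eq_intros)
    from DERIV_cmult[OF DERIV_inverse'[OF this]] s[OF that] show ?thesis
      unfolding W_def[abs_def] W'_def by simp
  qed
  have dV: "(V has_real_derivative cos ((real m + 1 / 2) * y) * W' y) (at y)" if y: "0 < y" "y \<le> pi" for y
  proof -
    have "((\<lambda>x. cos ((real m + 1 / 2) * x)) has_real_derivative
        - sin ((real m + 1 / 2) * y) * (real m + 1 / 2)) (at y)"
      by (auto intro!: derivative_eq_intros)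
    note D = DERIV_add[OF dT DERIV_mult[OF this dW[OF y]]]
    moreover have "1 / 2 + (\<Sum>k=1..m. cos (real k * y)) = sin ((real m + 1 / 2) * y) * (real m + 1 / 2) * W y"
    proof -
      have "sin ((real m + 1 / 2) * y) * (real m + 1 / 2) * W y
          = sin ((real m + 1 / 2) * y) * (c * (real m + 1 / 2)) * inverse (sin (y / 2))"
        by (simp add: W_def)
      also have "\<dots> = sin ((real m + 1 / 2) * y) / (2 * sin (y / 2))"
        unfolding c(2) by (simp add: inverse_eq_divide)
      also have "\<dots> = 1 / 2 + (\<Sum>k=1..m. cos (real k * y))"
        using s[OF y] by (simp only: dirichlet_kernel[symmetric]) simp
      finally show ?thesis ..
    qed
    ultimately show ?thesis using D by (simp add: V_def[abs_def] mult.commute)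
  qed
  have W'0: "W' y \<le> 0" if "0 < y" "y \<le> pi" for y
  proof -
    have "cos (y / 2) \<ge> 0" using that by (intro cos_ge_zero) auto
    then show ?thesis unfolding W'_def using s[OF that] c(1)
      by (intro mult_nonneg_nonpos) auto
  qed
  have cW: "\<bar>cos z * W' y\<bar> \<le> - W' y" if "0 < y" "y \<le> pi" for y z
    using W'0[OF that] abs_cos_le_one[of z] unfolding abs_mult
    by (metis abs_ge_zero abs_of_nonpos mult_left_le_one_le)
  have "cos ((real m + 1 / 2) * pi) = 0"
    by (simp add: distrib_right cos_add sin_npi)
  then have Vpi: "V pi = 0"
    by (simp add: V_def T_def)
  have "V pi + W pi \<le> V x + W x"
  proof (rule DERIV_nonpos_imp_nonincreasing[OF x(2)])
    fix y assume "x \<le> y" "y \<le> pi"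
    then have y: "0 < y" "y \<le> pi" using x by auto
    show "\<exists>D. ((\<lambda>x. V x + W x) has_real_derivative D) (at y) \<and> D \<le> 0"
      using DERIV_add[OF dV[OF y] dW[OF y]] cW[OF y, of "(real m + 1 / 2) * y"]
      by (intro exI[of _ "cos ((real m + 1 / 2) * y) * W' y + W' y"]) auto
  qed
  moreover have "W pi - V pi \<le> W x - V x"
  proof (rule DERIV_nonpos_imp_nonincreasing[OF x(2)])
    fix y assume "x \<le> y" "y \<le> pi"
    then have y: "0 < y" "y \<le> pi" using x by auto
    show "\<exists>D. ((\<lambda>x. W x - V x) has_real_derivative D) (at y) \<and> D \<le> 0"
      using DERIV_diff[OF dW[OF y] dV[OF y]] cW[OF y, of "(real m + 1 / 2) * y"]
      by (intro exI[of _ "W' y - cos ((real m + 1 / 2) * y) * W' y"]) auto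
  qed
  moreover have "W pi \<ge> 0" "W x \<ge> 0" using s[OF x] c(1) by (auto simp: W_def)
  ultimately have "\<bar>V x\<bar> \<le> W x" using Vpi by linarith
  moreover have "\<bar>cos ((real m + 1 / 2) * x) * W x\<bar> \<le> 1 * W x"
    unfolding abs_mult using \<open>W x \<ge> 0\<close> by (intro mult_mono) auto
  ultimately have "\<bar>T x\<bar> \<le> 2 * W x" unfolding V_def by linarith
  then show ?thesis by (simp add: T_def W_def c_def field_simps)
qed

lemma sq_series_rem_tendsto_zero:
  assumes x: "0 < x" "x < 2 * pi"
  shows "(\<lambda>m. sq_series_rem m x) \<longlonglongrightarrow> 0"
proof -
  have main: "(\<lambda>m. sq_series_rem m x) \<longlonglongrightarrow> 0" if x: "0 < x" "x \<le> pi" for x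
  proof -
    have s: "sin (x / 2) > 0" using x by (intro sin_gt_zero) auto
    have "\<bar>sq_series_rem m x\<bar> \<le> pi * 2 / sin (x / 2) * inverse (real (Suc m))" for m
    proof (cases "x = pi")
      case False
      then have xp: "x < pi" using x by simp
      obtain z where z: "x < z" "z < pi" "sq_series_rem m pi - sq_series_rem m x
          = (pi - x) * ((z - pi) / 2 + (\<Sum>k=1..m. sin (real k * z) / real k))"
        using MVT2[OF xp DERIV_sq_series_rem] by blast
      have "\<bar>sq_series_rem m x\<bar> = (pi - x) * \<bar>(z - pi) / 2 + (\<Sum>k=1..m. sin (real k * z) / real k)\<bar>"
        using arg_cong[OF z(3), of abs] xp by (simp add: abs_mult)
      also have "\<dots> \<le> pi * (2 / ((2 * real m + 1) * sin (z / 2)))"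
        using abs_sawtooth_rem_le[of z m] z x by (intro mult_mono) auto
      also have "\<dots> \<le> pi * (2 / (real (Suc m) * sin (x / 2)))"
      proof -
        have "sin (x / 2) \<le> sin (z / 2)"
          using x z by (intro sin_monotone_2pi_le) auto
        then show ?thesis
          using s by (intro mult_left_mono divide_left_mono mult_mono mult_pos_pos) auto
      qed
      also have "\<dots> = pi * 2 / sin (x / 2) * inverse (real (Suc m))"
        by (simp add: field_simps)
      finally show ?thesis .
    qed (use s in simp)
    note b = this
    have "(\<lambda>m. pi * 2 / sin (x / 2) * inverse (real (Suc m))) \<longlonglongrightarrow> pi * 2 / sin (x / 2) * 0"
      by (intro tendsto_mult tendsto_const LIMSEQ_inverse_real_of_nat)
    then have "(\<lambda>m. pi * 2 / sin (x / 2) * inverse (real (Suc m))) \<longlonglongrightarrow> 0" by simp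
    then show ?thesis
      by (rule Lim_null_comparison[rotated]) (use b in simp)
  qed
  show ?thesis
  proof (cases "x \<le> pi")
    case False
    then show ?thesis using main[of "2 * pi - x"] x unfolding sq_series_rem_reflect by simp
  qed (use main x in auto)
qed

lemma sq_series_rem_diff:
  assumes "m < M"
  shows "sq_series_rem m x - sq_series_rem (M - 1) x =
    (\<Sum>k=Suc m..<M. 1 / (real k)\<^sup>2 * cos (real k * x)) - (\<Sum>k=Suc m..<M. 1 / (real k)\<^sup>2 * cos (real k * pi))"
proof -
  have "{1..M - 1} = {1..m} \<union> {Suc m..<M}" using assms by auto
  then have "(\<Sum>k=1..M - 1. (cos (real k * x) - cos (real k * pi)) / (real k)\<^sup>2)
     = (\<Sum>k=1..m. (cos (real k * x) - cos (real k * pi)) / (real k)\<^sup>2)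
     + (\<Sum>k=Suc m..<M. (cos (real k * x) - cos (real k * pi)) / (real k)\<^sup>2)"
    by (simp only:) (rule sum.union_disjoint, auto)
  then show ?thesis
    by (simp add: sq_series_rem_def sum_subtractf diff_divide_distrib)
qed

lemma inverse_squares_sum_le:
  assumes "1 \<le> m" "m < M"
  shows "(\<Sum>k=Suc m..<M. 1 / (real k)\<^sup>2) \<le> 1 / real m"
proof -
  have le: "(\<Sum>k=Suc m..<M. 1 / (real k)\<^sup>2) \<le> 1 / real m - 1 / real (M - 1)"
    using Suc_leI[OF assms(2)]
  proof (induction M rule: dec_induct)
    case (step N)
    obtain K where K: "N = Suc K" "1 \<le> K" using step assms by (cases N) auto
    have "1 / (real (Suc K))\<^sup>2 \<le> 1 / real K - 1 / real (Suc K)"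
    proof -
      have "1 / real K - 1 / real (Suc K) = 1 / (real K * real (Suc K))"
        using K by (simp add: field_simps)
      also have "\<dots> \<ge> 1 / (real (Suc K))\<^sup>2"
        unfolding power2_eq_square using K by (intro divide_left_mono mult_right_mono mult_pos_pos) auto
      finally show ?thesis .
    qed
    then show ?case using step K by simp
  qed simp
  show ?thesis by (rule order_trans[OF le]) simp
qed

text \<open>
  Both bounds hold for the finite sums from \<open>m + 1\<close> to \<open>M - 1\<close>, by summation by parts and by
  comparison with a telescoping sum; then \<open>M\<close> tends to infinity. The finite sum at \<open>pi\<close>, which the
  normalization subtracts, obeys the same bounds.
\<close>

lemma sq_series_rem_decay_open:
  assumes x: "0 < x" "x < 2 * pi"
  shows "\<bar>sin (x / 2)\<bar> * \<bar>sq_series_rem m x\<bar> \<le> 2 / (real (Suc m))\<^sup>2"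
    and "m \<ge> 1 \<Longrightarrow> \<bar>sq_series_rem m x\<bar> \<le> 2 / real m"
proof -
  define R where "R M y = (\<Sum>k=Suc m..<M. 1 / (real k)\<^sup>2 * cos (real k * y))" for M y
  \<comment> \<open>the value at 0 only makes the sequence decreasing\<close>
  define a where "a k = (if k = 0 then 1 else 1 / (real k)\<^sup>2)" for k :: nat
  have adec: "a (Suc k) \<le> a k" for k
    unfolding a_def by (auto intro!: divide_left_mono power_mono)
  have anon: "0 \<le> a k" for k by (simp add: a_def)
  have R: "\<bar>sin (y / 2)\<bar> * \<bar>R M y\<bar> \<le> 1 / (real (Suc m))\<^sup>2" for M y
  proof -
    have "R M y = (\<Sum>k=Suc m..<M. a k * cos (real k * y))"
      unfolding R_def by (intro sum.cong) (auto simp: a_def)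
    then show ?thesis
      using abel_cos_sum_bound[of a y m M, OF adec anon] by (simp add: a_def abs_mult)
  qed
  have Rpi: "\<bar>R M pi\<bar> \<le> 1 / (real (Suc m))\<^sup>2" for M
    using R[of pi M] by simp
  have lim: "(\<lambda>M. sq_series_rem (M - 1) x) \<longlonglongrightarrow> 0"
    using LIMSEQ_imp_Suc[of "\<lambda>M. sq_series_rem (M - 1) x"] sq_series_rem_tendsto_zero[OF x] by simp
  have b: "\<bar>sq_series_rem m x\<bar> \<le> \<bar>R M x\<bar> + \<bar>R M pi\<bar> + \<bar>sq_series_rem (M - 1) x\<bar>" if "m < M" for M
    using sq_series_rem_diff[OF that, of x] unfolding R_def[symmetric] by linarith
  show "\<bar>sin (x / 2)\<bar> * \<bar>sq_series_rem m x\<bar> \<le> 2 / (real (Suc m))\<^sup>2"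
  proof (rule LIMSEQ_le_const)
    show "(\<lambda>M. 2 / (real (Suc m))\<^sup>2 + \<bar>sq_series_rem (M - 1) x\<bar>) \<longlonglongrightarrow> 2 / (real (Suc m))\<^sup>2"
      using tendsto_add[OF tendsto_const tendsto_rabs_zero[OF lim]] by simp
    have "\<bar>sin (x / 2)\<bar> * \<bar>sq_series_rem m x\<bar> \<le> 2 / (real (Suc m))\<^sup>2 + \<bar>sq_series_rem (M - 1) x\<bar>"
      if "m < M" for M
    proof -
      have "\<bar>sin (x / 2)\<bar> * \<bar>sq_series_rem m x\<bar>
          \<le> \<bar>sin (x / 2)\<bar> * (\<bar>R M x\<bar> + \<bar>R M pi\<bar> + \<bar>sq_series_rem (M - 1) x\<bar>)"
        using b[OF that] by (intro mult_left_mono) auto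
      also have "\<dots> \<le> \<bar>sin (x / 2)\<bar> * \<bar>R M x\<bar> + 1 * \<bar>R M pi\<bar> + 1 * \<bar>sq_series_rem (M - 1) x\<bar>"
        unfolding distrib_left by (intro add_mono mult_right_mono) auto
      also have "\<dots> \<le> 2 / (real (Suc m))\<^sup>2 + \<bar>sq_series_rem (M - 1) x\<bar>"
        using R[of x M] Rpi[of M] by simp
      finally show ?thesis .
    qed
    then show "\<exists>N. \<forall>M\<ge>N. \<bar>sin (x / 2)\<bar> * \<bar>sq_series_rem m x\<bar>
        \<le> 2 / (real (Suc m))\<^sup>2 + \<bar>sq_series_rem (M - 1) x\<bar>"
      by (intro exI[of _ "Suc m"]) auto
  qed
  show "\<bar>sq_series_rem m x\<bar> \<le> 2 / real m" if m: "m \<ge> 1"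
  proof (rule LIMSEQ_le_const)
    show "(\<lambda>M. 2 / real m + \<bar>sq_series_rem (M - 1) x\<bar>) \<longlonglongrightarrow> 2 / real m"
      using tendsto_add[OF tendsto_const tendsto_rabs_zero[OF lim]] by simp
    have Rm: "\<bar>R M y\<bar> \<le> 1 / real m" if "m < M" for M y
    proof -
      have "\<bar>R M y\<bar> \<le> (\<Sum>k=Suc m..<M. 1 / (real k)\<^sup>2)"
        unfolding R_def
        by (rule order_trans[OF sum_abs sum_mono]) (auto simp: abs_mult divide_right_mono)
      then show ?thesis using inverse_squares_sum_le[OF m that] by linarith
    qed
    have "\<bar>sq_series_rem m x\<bar> \<le> 2 / real m + \<bar>sq_series_rem (M - 1) x\<bar>" if "m < M" for M
      using b[OF that] Rm[OF that, of x] Rm[OF that, of pi] by simp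
    then show "\<exists>N. \<forall>M\<ge>N. \<bar>sq_series_rem m x\<bar> \<le> 2 / real m + \<bar>sq_series_rem (M - 1) x\<bar>"
      by (intro exI[of _ "Suc m"]) auto
  qed
qed

lemma isCont_sq_series_rem: "isCont (sq_series_rem m) x"
  using DERIV_sq_series_rem by (rule DERIV_isCont)

lemma sq_series_rem_decay:
  assumes x: "0 \<le> x" "x \<le> 2 * pi" and m: "m \<ge> 1"
  shows "\<bar>sin (x / 2)\<bar> * \<bar>sq_series_rem m x\<bar> \<le> 2 / (real (Suc m))\<^sup>2"
    and "\<bar>sq_series_rem m x\<bar> \<le> 2 / real m"
proof -
  have "closed {y. \<bar>sin (y / 2)\<bar> * \<bar>sq_series_rem m y\<bar> \<le> 2 / (real (Suc m))\<^sup>2 \<and> \<bar>sq_series_rem m y\<bar> \<le> 2 / real m}"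
    by (intro closed_Collect_conj closed_Collect_le continuous_intros
        continuous_at_imp_continuous_on) (auto intro: isCont_sq_series_rem)
  then have "closure {0<..<2 * pi} \<subseteq> {y. \<bar>sin (y / 2)\<bar> * \<bar>sq_series_rem m y\<bar> \<le> 2 / (real (Suc m))\<^sup>2
      \<and> \<bar>sq_series_rem m y\<bar> \<le> 2 / real m}"
    using sq_series_rem_decay_open m by (intro closure_minimal) auto
  then show "\<bar>sin (x / 2)\<bar> * \<bar>sq_series_rem m x\<bar> \<le> 2 / (real (Suc m))\<^sup>2"
    and "\<bar>sq_series_rem m x\<bar> \<le> 2 / real m"
    using x by (auto simp: closure_greaterThanLessThan)
qed

section \<open>Cosine approximation with kinks at the end points\<close>

text \<open>
  The error of the cosine polynomial that approximates \<open>f\<close>, in terms of the first two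
  derivatives \<open>f'\<close> and \<open>f''\<close>. The first two summands belong to the kinks which the even periodic
  extension of \<open>f\<close> has at \<open>pi\<close> and at 0; the integral is the error of approximating the kernel
  \<open>max t u\<close>, the part depending on \<open>t\<close> of the kernel in Taylor's formula with integral remainder.
\<close>

definition green_rem :: "(real \<Rightarrow> real) \<Rightarrow> (real \<Rightarrow> real) \<Rightarrow> nat \<Rightarrow> real \<Rightarrow> real" where
  "green_rem f' f'' m t = 2 / pi * f' pi * sq_series_rem m (pi - t) - 2 / pi * f' 0 * sq_series_rem m t
     - 1 / pi * integral {0..pi} (\<lambda>u. (sq_series_rem m \<bar>t - u\<bar> + sq_series_rem m (t + u)) * f'' u)"

lemma integral_max_times_deriv2:
  fixes f f' f'' :: "real \<Rightarrow> real"
  assumes f': "\<And>x. x \<in> {0..pi} \<Longrightarrow> (f has_real_derivative f' x) (at x within {0..pi})"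
    and f'': "\<And>x. x \<in> {0..pi} \<Longrightarrow> (f' has_real_derivative f'' x) (at x within {0..pi})"
    and t: "t \<in> {0..pi}"
  shows "((\<lambda>u. max t u * f'' u) has_integral f t - f pi + pi * f' pi - t * f' 0) {0..pi}"
proof -
  have "((\<lambda>u. max t u * f'' u) has_integral t * f' t - t * f' 0) {0..t}"
  proof (rule has_integral_eq)
    show "((\<lambda>u. t * f'' u) has_integral t * f' t - t * f' 0) {0..t}"
    proof (rule fundamental_theorem_of_calculus)
      fix x assume "x \<in> {0..t}"
      then have "(f' has_real_derivative f'' x) (at x within {0..t})"
        using t by (intro has_field_derivative_subset[OF f'']) auto
      then show "((\<lambda>u. t * f' u) has_vector_derivative t * f'' x) (at x within {0..t})"
        unfolding has_real_derivative_iff_has_vector_derivative[symmetric]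
        by (auto intro!: derivative_eq_intros)
    qed (use t in auto)
  qed (auto simp: max_def)
  moreover have "((\<lambda>u. max t u * f'' u) has_integral (pi * f' pi - f pi) - (t * f' t - f t)) {t..pi}"
  proof (rule has_integral_eq)
    show "((\<lambda>u. u * f'' u) has_integral (pi * f' pi - f pi) - (t * f' t - f t)) {t..pi}"
    proof (rule fundamental_theorem_of_calculus)
      fix x assume x: "x \<in> {t..pi}"
      then have "(f' has_real_derivative f'' x) (at x within {t..pi})"
        using t by (intro has_field_derivative_subset[OF f'']) auto
      moreover have "(f has_real_derivative f' x) (at x within {t..pi})"
        using t x by (intro has_field_derivative_subset[OF f']) auto
      ultimately show "((\<lambda>u. u * f' u - f u) has_vector_derivative x * f'' x) (at x within {t..pi})"
        unfolding has_real_derivative_iff_has_vector_derivative[symmetric]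
        by (auto intro!: derivative_eq_intros)
    qed (use t in auto)
  qed (auto simp: max_def)
  ultimately have "((\<lambda>u. max t u * f'' u) has_integral
      (t * f' t - t * f' 0) + ((pi * f' pi - f pi) - (t * f' t - f t))) {0..pi}"
    using t by (intro has_integral_combine[of 0 t pi]) auto
  then show ?thesis by (simp add: algebra_simps)
qed

lemma sq_series_rem_add_pair:
  "sq_series_rem m \<bar>t - u\<bar> + sq_series_rem m (t + u) = (t\<^sup>2 + u\<^sup>2) / 2 - pi * max t u + pi\<^sup>2 / 2
     - 2 * ((\<Sum>k=1..m. cos (real k * t) * cos (real k * u) / (real k)\<^sup>2)
            - (\<Sum>k=1..m. cos (real k * pi) / (real k)\<^sup>2))"
proof -
  define Q where "Q x = x\<^sup>2 / 4 - pi * x / 2" for x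
  define E where "E x = (\<Sum>k=1..m. cos (real k * x) / (real k)\<^sup>2)" for x
  have e: "sq_series_rem m x = Q x + pi\<^sup>2 / 4 - (E x - E pi)" for x
    by (simp add: sq_series_rem_def Q_def E_def diff_divide_distrib sum_subtractf power2_eq_square)
  have "Q \<bar>t - u\<bar> + Q (t + u) = (t\<^sup>2 + u\<^sup>2) / 2 - pi * max t u"
    by (cases "t \<le> u") (auto simp: Q_def max_def power2_eq_square field_simps)
  moreover have "E \<bar>t - u\<bar> + E (t + u) = 2 * (\<Sum>k=1..m. cos (real k * t) * cos (real k * u) / (real k)\<^sup>2)"
  proof -
    have "cos (real k * \<bar>t - u\<bar>) = cos (real k * t - real k * u)" for k
      by (metis cos_abs_real abs_mult abs_of_nat right_diff_distrib)
    then show ?thesis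
      unfolding E_def sum.distrib[symmetric] sum_distrib_left
      by (intro sum.cong) (auto simp: cos_diff cos_add distrib_left add_divide_distrib diff_divide_distrib)
  qed
  ultimately show ?thesis unfolding e E_def[of pi, symmetric] by simp
qed

lemma continuous_on_sq_series_rem: "continuous_on S (sq_series_rem m)"
  using isCont_sq_series_rem by (intro continuous_at_imp_continuous_on) auto

text \<open>
  Up to a constant, \<open>f t\<close> is \<open>t f'(0)\<close> plus the integral of \<open>max t u * f'' u\<close>. The kernel is a
  combination of the quadratic \<open>Q x = x^2 / 4 - pi x / 2\<close>, since
  \<open>pi * max t u = (t^2 + u^2) / 2 - Q \<bar>t - u\<bar> - Q (t + u)\<close>. Up to constants, \<open>t\<close> and
  \<open>t^2\<close> are combinations of \<open>Q t\<close> and \<open>Q (pi - t)\<close>. Replacing \<open>Q\<close> by the partial sum of its cosine series gives the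
  approximating polynomial.
\<close>

lemma cos_sum_plus_green_rem:
  fixes f f' f'' :: "real \<Rightarrow> real"
  assumes f': "\<And>x. x \<in> {0..pi} \<Longrightarrow> (f has_real_derivative f' x) (at x within {0..pi})"
    and f'': "\<And>x. x \<in> {0..pi} \<Longrightarrow> (f' has_real_derivative f'' x) (at x within {0..pi})"
    and cont: "continuous_on {0..pi} f''"
  shows "\<exists>c. \<forall>t\<in>{0..pi}. f t = (\<Sum>i\<le>m. c i * cos (real i * t)) + green_rem f' f'' m t"
proof -
  define I0 where "I0 = f' pi - f' 0"
  define I2 where "I2 = integral {0..pi} (\<lambda>u. u\<^sup>2 * f'' u)"
  define C where "C k = integral {0..pi} (\<lambda>u. cos (real k * u) * f'' u)" for k :: nat
  define A where "A = (\<Sum>k=1..m. cos (real k * pi) / (real k)\<^sup>2)"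
  define B where "B t = (\<Sum>k=1..m. cos (real k * pi) * cos (real k * t) / (real k)\<^sup>2)" for t
  define E where "E t = (\<Sum>k=1..m. cos (real k * t) / (real k)\<^sup>2)" for t
  define F where "F t = (\<Sum>k=1..m. cos (real k * t) / (real k)\<^sup>2 * C k)" for t
  define K where "K = - 2 / pi * f' pi * A + 2 / pi * f' 0 * (pi\<^sup>2 / 4 + A)
      + 1 / pi * (I2 / 2 + pi\<^sup>2 / 2 * I0 + 2 * A * I0) + f pi - pi * f' pi"
  define c where "c k = (if k = 0 then K
      else 2 / pi * (f' pi * cos (real k * pi) - f' 0 - C k) / (real k)\<^sup>2)" for k :: nat
  have "f t = (\<Sum>i\<le>m. c i * cos (real i * t)) + green_rem f' f'' m t" if t: "t \<in> {0..pi}" for t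
  proof -
    define J where "J = f t - f pi + pi * f' pi - t * f' 0"
    have e1: "sq_series_rem m t = t\<^sup>2 / 4 - pi * t / 2 + pi\<^sup>2 / 4 - (E t - A)"
      by (simp add: sq_series_rem_def E_def A_def diff_divide_distrib sum_subtractf power2_eq_square)
    have "cos (real k * (pi - t)) = cos (real k * pi) * cos (real k * t)" for k
      by (simp add: right_diff_distrib cos_diff)
    then have e2: "sq_series_rem m (pi - t) = t\<^sup>2 / 4 - (B t - A)"
      by (simp add: sq_series_rem_def B_def A_def diff_divide_distrib sum_subtractf)
        (simp add: power2_eq_square field_simps)
    have i0: "(f'' has_integral I0) {0..pi}"
      unfolding I0_def using f'' by (intro fundamental_theorem_of_calculus)
        (auto simp: has_real_derivative_iff_has_vector_derivative[symmetric])
    have i2: "((\<lambda>u. u\<^sup>2 * f'' u) has_integral I2) {0..pi}"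
      unfolding I2_def by (intro integrable_integral integrable_continuous_interval continuous_intros cont)
    have ic: "((\<lambda>u. cos (real k * u) * f'' u) has_integral C k) {0..pi}" for k
      unfolding C_def by (intro integrable_integral integrable_continuous_interval continuous_intros cont)
    have iJ: "((\<lambda>u. max t u * f'' u) has_integral J) {0..pi}"
      unfolding J_def by (rule integral_max_times_deriv2[OF f' f'' t])
    have "((\<lambda>u. (t\<^sup>2 / 2 + pi\<^sup>2 / 2 + 2 * A) * f'' u + 1 / 2 * (u\<^sup>2 * f'' u) - pi * (max t u * f'' u)
        - 2 * (\<Sum>k=1..m. cos (real k * t) / (real k)\<^sup>2 * (cos (real k * u) * f'' u)))
      has_integral (t\<^sup>2 / 2 + pi\<^sup>2 / 2 + 2 * A) * I0 + 1 / 2 * I2 - pi * J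
        - 2 * (\<Sum>k=1..m. cos (real k * t) / (real k)\<^sup>2 * C k)) {0..pi}"
      by (intro has_integral_add has_integral_diff has_integral_mult_right has_integral_sum i0 i2 ic iJ) auto
    moreover have "(t\<^sup>2 / 2 + pi\<^sup>2 / 2 + 2 * A) * f'' u + 1 / 2 * (u\<^sup>2 * f'' u) - pi * (max t u * f'' u)
        - 2 * (\<Sum>k=1..m. cos (real k * t) / (real k)\<^sup>2 * (cos (real k * u) * f'' u))
      = (sq_series_rem m \<bar>t - u\<bar> + sq_series_rem m (t + u)) * f'' u" for u
    proof -
      have "(\<Sum>k=1..m. cos (real k * t) / (real k)\<^sup>2 * (cos (real k * u) * f'' u))
        = (\<Sum>k=1..m. cos (real k * t) * cos (real k * u) / (real k)\<^sup>2) * f'' u"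
        unfolding sum_distrib_right by (intro sum.cong) (auto simp: mult_ac)
      then show ?thesis
        unfolding sq_series_rem_add_pair A_def by (simp add: field_simps)
    qed
    ultimately have int: "integral {0..pi} (\<lambda>u. (sq_series_rem m \<bar>t - u\<bar> + sq_series_rem m (t + u)) * f'' u)
      = (t\<^sup>2 / 2 + pi\<^sup>2 / 2 + 2 * A) * I0 + 1 / 2 * I2 - pi * J - 2 * F t"
      unfolding F_def by (simp add: integral_unique)
    have "{..m} = insert 0 {1..m}" by auto
    then have "(\<Sum>i\<le>m. c i * cos (real i * t)) = c 0 + (\<Sum>i=1..m. c i * cos (real i * t))"
      by simp
    also have "(\<Sum>i=1..m. c i * cos (real i * t)) =
      (\<Sum>k=1..m. 2 / pi * f' pi * (cos (real k * pi) * cos (real k * t) / (real k)\<^sup>2)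
          - 2 / pi * f' 0 * (cos (real k * t) / (real k)\<^sup>2) - 2 / pi * (cos (real k * t) / (real k)\<^sup>2 * C k))"
      by (intro sum.cong) (auto simp: c_def field_simps)
    also have "\<dots> = 2 / pi * f' pi * B t - 2 / pi * f' 0 * E t - 2 / pi * F t"
      by (simp add: sum_subtractf B_def E_def F_def sum_distrib_left)
    finally have cs: "(\<Sum>i\<le>m. c i * cos (real i * t)) = K + (2 / pi * f' pi * B t - 2 / pi * f' 0 * E t - 2 / pi * F t)"
      by (simp add: c_def)
    show ?thesis
      unfolding cs green_rem_def e1 e2 int K_def J_def I0_def
      by (simp add: field_simps power2_eq_square)
  qed
  then show ?thesis by blast
qed

lemma card_progression_near_le:
  fixes c a r :: real
  assumes "c > 0" "r \<ge> 0" "finite A"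
  shows "real (card {k\<in>A. \<bar>c * real k - a\<bar> < r}) \<le> 2 * r / c + 1"
proof (cases "{k\<in>A. \<bar>c * real k - a\<bar> < r} = {}")
  case True
  then show ?thesis using assms by (simp add: add_nonneg_nonneg del: Collect_empty_eq)
next
  case False
  define S where "S = {k\<in>A. \<bar>c * real k - a\<bar> < r}"
  have S: "finite S" "S \<noteq> {}" using False assms by (auto simp: S_def)
  have "S \<subseteq> {Min S..Max S}" using S by auto
  then have "card S \<le> card {Min S..Max S}" by (intro card_mono) auto
  then have "card S \<le> Max S + 1 - Min S" by simp
  moreover have le: "Min S \<le> Max S" using S by simp
  ultimately have "real (card S) \<le> real (Max S) - real (Min S) + 1"
    by linarith
  moreover have "real (Max S) - real (Min S) \<le> 2 * r / c"
  proof -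
    have "\<bar>c * real (Max S) - a\<bar> < r" "\<bar>c * real (Min S) - a\<bar> < r"
      using Max_in[OF S] Min_in[OF S] by (auto simp: S_def)
    then have "c * (real (Max S) - real (Min S)) \<le> 2 * r"
      by (simp add: right_diff_distrib)
    then show ?thesis using assms(1) by (simp add: field_simps)
  qed
  ultimately show ?thesis by (simp add: S_def)
qed

lemma near_zero_mod_2pi:
  assumes x: "0 \<le> x" "x \<le> 2 * pi" and s: "\<bar>sin (x / 2)\<bar> < r"
  shows "x < pi * r \<or> 2 * pi - x < pi * r"
proof (cases "x \<le> pi")
  case True
  then have "2 * (x / 2) / pi \<le> sin (x / 2)" using x by (intro half_le_sin) auto
  then have "x / pi < r" using s by simp
  then show ?thesis by (simp add: divide_less_eq mult.commute)
next
  case False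
  then have "2 * ((2 * pi - x) / 2) / pi \<le> sin ((2 * pi - x) / 2)" using x by (intro half_le_sin) auto
  also have "sin ((2 * pi - x) / 2) = sin (x / 2)"
    by (simp add: diff_divide_distrib sin_diff)
  finally have "2 * ((2 * pi - x) / 2) / pi < r" using s by linarith
  then have "(2 * pi - x) / pi < r" by (simp only: times_divide_eq_right)
  then show ?thesis by (simp add: divide_less_eq mult.commute)
qed

text \<open>
  The remainder is of size \<open>1 / n\<close> at every point, but of size \<open>1 / (n^2 \<bar>sin (x / 2)\<bar>)\<close> away from
  the multiples of \<open>2 pi\<close>. Nodes with \<open>\<bar>sin (x / 2)\<bar> < 1 / sqrt n\<close> number at most a
  constant times \<open>sqrt n\<close>, which balances the two contributions.
\<close>

lemma sum_sq_series_rem_nodes_le: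
  assumes n: "n \<ge> 2" and d: "d \<in> {- (pi / (2 * real n))<..<pi / (2 * real n)}"
    and u: "- pi \<le> u" "u \<le> pi"
  shows "(\<Sum>k=1..n. \<bar>sq_series_rem (n - 1) \<bar>shifted_angle n d k + u\<bar>\<bar>) \<le> 38 / sqrt (real n)"
proof -
  define y where "y k = shifted_angle n d k + u" for k
  \<comment> \<open>nodes within about \<open>1 / q\<close> of a multiple of \<open>2 pi\<close> are estimated separately\<close>
  define q where "q = sqrt (real n)"
  define h where "h = pi / (2 * real n)"
  have q: "q \<ge> 1" "q * q = real n" using n by (auto simp: q_def)
  have y: "\<bar>y k\<bar> \<le> 2 * pi" if "k \<in> {1..n}" for k
    using shifted_angle_in[OF _ d that] n u by (auto simp: y_def)
  define N where "N = {k\<in>{1..n}. \<bar>sin (\<bar>y k\<bar> / 2)\<bar> < 1 / q}"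
  have h: "h > 0" using n by (simp add: h_def)
  have yk: "y k = 2 * h * real k - (h + d - u)" for k
  proof -
    have "shifted_angle n d k = (2 * real k - 1) * h - d"
      by (simp add: h_def shifted_angle_def)
    then show ?thesis by (simp add: y_def algebra_simps)
  qed
  have near: "real (card {k\<in>{1..n}. \<bar>y k - b\<bar> < pi / q}) \<le> 3 * q" for b
  proof -
    have "{k\<in>{1..n}. \<bar>y k - b\<bar> < pi / q} = {k\<in>{1..n}. \<bar>2 * h * real k - (h + d - u + b)\<bar> < pi / q}"
      by (auto simp: yk algebra_simps)
    then have "real (card {k\<in>{1..n}. \<bar>y k - b\<bar> < pi / q}) \<le> 2 * (pi / q) / (2 * h) + 1"
      using card_progression_near_le[of "2 * h" "pi / q" "{1..n}" "h + d - u + b"] h q by simp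
    also have "2 * (pi / q) / (2 * h) = 2 * q"
      using q n by (simp add: h_def field_simps)
    finally show ?thesis using q by simp
  qed
  \<comment> \<open>\<open>y k\<close> ranges over \<open>[- 2 pi, 2 pi]\<close>, which contains three multiples of \<open>2 pi\<close>\<close>
  have "N \<subseteq> {k\<in>{1..n}. \<bar>y k - 0\<bar> < pi / q} \<union> {k\<in>{1..n}. \<bar>y k - 2 * pi\<bar> < pi / q}
      \<union> {k\<in>{1..n}. \<bar>y k - (- 2 * pi)\<bar> < pi / q}"
  proof
    fix k assume k: "k \<in> N"
    then have "\<bar>y k\<bar> < pi * (1 / q) \<or> 2 * pi - \<bar>y k\<bar> < pi * (1 / q)"
      using y by (intro near_zero_mod_2pi) (auto simp: N_def)
    moreover have "\<bar>y k\<bar> \<le> 2 * pi" using k y by (auto simp: N_def)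
    ultimately show "k \<in> {k\<in>{1..n}. \<bar>y k - 0\<bar> < pi / q} \<union> {k\<in>{1..n}. \<bar>y k - 2 * pi\<bar> < pi / q}
      \<union> {k\<in>{1..n}. \<bar>y k - (- 2 * pi)\<bar> < pi / q}"
      using k by (auto simp: N_def)
  qed
  then have "card N \<le> card ({k\<in>{1..n}. \<bar>y k - 0\<bar> < pi / q} \<union> {k\<in>{1..n}. \<bar>y k - 2 * pi\<bar> < pi / q}
      \<union> {k\<in>{1..n}. \<bar>y k - (- 2 * pi)\<bar> < pi / q})"
    by (intro card_mono) auto
  also have "\<dots> \<le> card {k\<in>{1..n}. \<bar>y k - 0\<bar> < pi / q} + card {k\<in>{1..n}. \<bar>y k - 2 * pi\<bar> < pi / q}
      + card {k\<in>{1..n}. \<bar>y k - (- 2 * pi)\<bar> < pi / q}"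
    by (rule order_trans[OF card_Un_le add_right_mono[OF card_Un_le]])
  finally have cN: "real (card N) \<le> 9 * q"
    using near[of 0] near[of "2 * pi"] near[of "- 2 * pi"] by linarith
  have m: "n - 1 \<ge> 1" "Suc (n - 1) = n" using n by auto
  have m2: "2 / real (n - 1) \<le> 4 / real n"
    using n by (simp add: field_simps of_nat_diff)
  have "(\<Sum>k=1..n. \<bar>sq_series_rem (n - 1) \<bar>y k\<bar>\<bar>)
      \<le> (\<Sum>k=1..n. (if k \<in> N then 4 / real n else 0) + 2 / (real n * q))"
  proof (rule sum_mono)
    fix k assume k: "k \<in> {1..n}"
    note b = sq_series_rem_decay[of "\<bar>y k\<bar>" "n - 1", OF abs_ge_zero y[OF k] m(1)]
    show "\<bar>sq_series_rem (n - 1) \<bar>y k\<bar>\<bar> \<le> (if k \<in> N then 4 / real n else 0) + 2 / (real n * q)"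
    proof (cases "k \<in> N")
      case True
      have "0 \<le> 2 / (real n * q)" using q by simp
      from add_increasing2[OF this order_trans[OF b(2) m2]] show ?thesis
        using True by (simp only: if_True)
    next
      case False
      then have "1 / q \<le> \<bar>sin (\<bar>y k\<bar> / 2)\<bar>" using k by (simp add: N_def)
      then have "1 / q * \<bar>sq_series_rem (n - 1) \<bar>y k\<bar>\<bar> \<le> \<bar>sin (\<bar>y k\<bar> / 2)\<bar> * \<bar>sq_series_rem (n - 1) \<bar>y k\<bar>\<bar>"
        by (intro mult_right_mono) auto
      also have "\<dots> \<le> 2 / (real n)\<^sup>2" using b(1) m(2) by simp
      finally have "\<bar>sq_series_rem (n - 1) \<bar>y k\<bar>\<bar> \<le> q * (2 / (real n)\<^sup>2)"
        using q by (simp add: divide_le_eq mult.commute)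
      also have "\<dots> = 2 / (real n * q)"
        unfolding q(2)[symmetric] using q(1) by (simp add: power2_eq_square field_simps)
      finally show ?thesis using False by simp
    qed
  qed
  also have "\<dots> = real (card N) * (4 / real n) + 2 / q"
  proof -
    have "(\<Sum>k=1..n. if k \<in> N then 4 / real n else 0) = (\<Sum>k\<in>{1..n} \<inter> N. 4 / real n)"
      by (rule sum.inter_restrict[symmetric]) simp
    also have "{1..n} \<inter> N = N" by (auto simp: N_def)
    finally show ?thesis using n by (simp add: sum.distrib)
  qed
  also have "\<dots> \<le> 9 * q * (4 / real n) + 2 / q"
    using cN by (intro add_right_mono mult_right_mono) auto
  also have "9 * q * (4 / real n) = 36 / q"
    unfolding q(2)[symmetric] using q(1) by (simp add: field_simps)
  also have "36 / q + 2 / q = 38 / q" by (simp add: add_divide_distrib[symmetric])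
  finally show ?thesis by (simp add: y_def q_def)
qed

section \<open>Error of interpolation and of the Gruenwald operator\<close>

text \<open>
  The sum over the nodes is taken under the integral sign, where the bound for the sum over the nodes
  applies to the translates by \<open>u\<close> and by \<open>- u\<close>.
\<close>

lemma green_rem_bounds:
  fixes f' f'' :: "real \<Rightarrow> real"
  assumes n: "n \<ge> 2" and d: "d \<in> {- (pi / (2 * real n))<..<pi / (2 * real n)}"
    and cont: "continuous_on {0..pi} f''" and B: "\<And>x. x \<in> {0..pi} \<Longrightarrow> \<bar>f'' x\<bar> \<le> B"
  defines "K \<equiv> \<bar>f' pi\<bar> + \<bar>f' 0\<bar> + 2 * B"
  shows "(\<Sum>k=1..n. \<bar>green_rem f' f'' (n - 1) (shifted_angle n d k)\<bar>) \<le> K * (38 / sqrt (real n))"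
    and "\<And>t. t \<in> {0..pi} \<Longrightarrow> \<bar>green_rem f' f'' (n - 1) t\<bar> \<le> K * (4 / real n)"
proof -
  define e where "e = sq_series_rem (n - 1)"
  define G where "G t u = \<bar>e \<bar>t + - u\<bar>\<bar> + \<bar>e \<bar>t + u\<bar>\<bar>" for t u
  have conte: "continuous_on S (\<lambda>u. e (g u))" if "continuous_on S g" for S :: "real set" and g
    unfolding e_def by (rule continuous_on_compose2[OF continuous_on_sq_series_rem[of UNIV] that]) auto
  have intG: "G t integrable_on {0..pi}" for t
    unfolding G_def by (intro integrable_continuous_interval continuous_intros conte)
  have B0: "0 \<le> B" using B[of 0] by simp
  have pt: "\<bar>green_rem f' f'' (n - 1) t\<bar> \<le> \<bar>f' pi\<bar> * \<bar>e \<bar>t + - pi\<bar>\<bar> + \<bar>f' 0\<bar> * \<bar>e \<bar>t + 0\<bar>\<bar>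
      + B / pi * integral {0..pi} (G t)" if t: "t \<in> {0..pi}" for t
  proof -
    have "\<bar>integral {0..pi} (\<lambda>u. (e \<bar>t - u\<bar> + e (t + u)) * f'' u)\<bar> \<le> integral {0..pi} (\<lambda>u. B * G t u)"
    proof (rule integral_norm_bound_integral[of "\<lambda>u. (e \<bar>t - u\<bar> + e (t + u)) * f'' u", unfolded real_norm_def])
      show "(\<lambda>u. (e \<bar>t - u\<bar> + e (t + u)) * f'' u) integrable_on {0..pi}"
        by (intro integrable_continuous_interval continuous_intros conte cont)
      show "(\<lambda>u. B * G t u) integrable_on {0..pi}"
        using intG by (rule integrable_on_mult_right)
      fix u assume u: "u \<in> {0..pi}"
      then have "\<bar>e \<bar>t - u\<bar> + e (t + u)\<bar> \<le> G t u"
        using t by (auto simp: G_def)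
      then have "\<bar>e \<bar>t - u\<bar> + e (t + u)\<bar> * \<bar>f'' u\<bar> \<le> G t u * B"
        using B[OF u] by (intro mult_mono) auto
      then show "\<bar>(e \<bar>t - u\<bar> + e (t + u)) * f'' u\<bar> \<le> B * G t u"
        by (simp add: abs_mult mult.commute)
    qed
    then have "\<bar>1 / pi * integral {0..pi} (\<lambda>u. (e \<bar>t - u\<bar> + e (t + u)) * f'' u)\<bar>
        \<le> B / pi * integral {0..pi} (G t)"
      by (simp add: abs_mult divide_right_mono)
    moreover have two: "2 / pi \<le> 1" using pi_ge_two by simp
    have "\<bar>2 / pi * f' pi * e (pi - t)\<bar> \<le> 1 * \<bar>f' pi\<bar> * \<bar>e \<bar>t + - pi\<bar>\<bar>"
      using t two by (simp only: abs_mult) (intro mult_mono, auto)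
    moreover have "\<bar>2 / pi * f' 0 * e t\<bar> \<le> 1 * \<bar>f' 0\<bar> * \<bar>e \<bar>t + 0\<bar>\<bar>"
      using t two by (simp only: abs_mult) (intro mult_mono, auto)
    ultimately show ?thesis
      unfolding green_rem_def e_def[symmetric] by linarith
  qed
  have se: "(\<Sum>k=1..n. \<bar>e \<bar>shifted_angle n d k + u\<bar>\<bar>) \<le> 38 / sqrt (real n)" if "- pi \<le> u" "u \<le> pi" for u
    unfolding e_def by (rule sum_sq_series_rem_nodes_le[OF n d that])
  have tk: "shifted_angle n d k \<in> {0..pi}" if "k \<in> {1..n}" for k
    using shifted_angle_in[OF _ d that] n by auto
  define s where "s = 38 / sqrt (real n)"
  have intsum: "(\<Sum>k=1..n. integral {0..pi} (G (shifted_angle n d k))) \<le> 2 * s * pi"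
  proof -
    have "(\<Sum>k=1..n. integral {0..pi} (G (shifted_angle n d k)))
        = integral {0..pi} (\<lambda>u. \<Sum>k=1..n. G (shifted_angle n d k) u)"
      using intG by (intro integral_sum[symmetric]) auto
    also have "\<dots> \<le> integral {0..pi} (\<lambda>u. 2 * s)"
    proof (rule integral_le)
      show "(\<lambda>u. \<Sum>k=1..n. G (shifted_angle n d k) u) integrable_on {0..pi}"
        using intG by (intro integrable_sum) auto
      fix u :: real assume "u \<in> {0..pi}"
      then have "- pi \<le> - u" "- u \<le> pi" "- pi \<le> u" "u \<le> pi" by auto
      note se[OF this(1,2)] se[OF this(3,4)]
      then show "(\<Sum>k=1..n. G (shifted_angle n d k) u) \<le> 2 * s"
        unfolding G_def sum.distrib s_def by linarith
    qed auto
    finally show ?thesis by (simp add: mult_ac)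
  qed
  have s: "(\<Sum>k=1..n. \<bar>e \<bar>shifted_angle n d k + - pi\<bar>\<bar>) \<le> s" "(\<Sum>k=1..n. \<bar>e \<bar>shifted_angle n d k + 0\<bar>\<bar>) \<le> s"
    unfolding s_def using se[of "- pi"] se[of 0] by auto
  have "(\<Sum>k=1..n. \<bar>green_rem f' f'' (n - 1) (shifted_angle n d k)\<bar>)
      \<le> (\<Sum>k=1..n. \<bar>f' pi\<bar> * \<bar>e \<bar>shifted_angle n d k + - pi\<bar>\<bar> + \<bar>f' 0\<bar> * \<bar>e \<bar>shifted_angle n d k + 0\<bar>\<bar>
          + B / pi * integral {0..pi} (G (shifted_angle n d k)))"
    using pt tk by (intro sum_mono) auto
  also have "\<dots> = \<bar>f' pi\<bar> * (\<Sum>k=1..n. \<bar>e \<bar>shifted_angle n d k + - pi\<bar>\<bar>)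
      + \<bar>f' 0\<bar> * (\<Sum>k=1..n. \<bar>e \<bar>shifted_angle n d k + 0\<bar>\<bar>)
      + B / pi * (\<Sum>k=1..n. integral {0..pi} (G (shifted_angle n d k)))"
    by (simp only: sum.distrib sum_distrib_left)
  also have "\<dots> \<le> \<bar>f' pi\<bar> * s + \<bar>f' 0\<bar> * s + B / pi * (2 * s * pi)"
    using B0 by (intro add_mono mult_left_mono s intsum) auto
  also have "\<dots> = K * s"
    by (simp add: K_def distrib_right)
  finally show "(\<Sum>k=1..n. \<bar>green_rem f' f'' (n - 1) (shifted_angle n d k)\<bar>) \<le> K * (38 / sqrt (real n))"
    by (simp only: s_def)
  fix t :: real assume t: "t \<in> {0..pi}"
  have eb: "\<bar>e \<bar>t + u\<bar>\<bar> \<le> 4 / real n" if "- pi \<le> u" "u \<le> pi" for u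
  proof -
    have "\<bar>e \<bar>t + u\<bar>\<bar> \<le> 2 / real (n - 1)"
      unfolding e_def using that t n by (intro sq_series_rem_decay(2)) auto
    also have "\<dots> \<le> 4 / real n" using n by (simp add: field_simps of_nat_diff)
    finally show ?thesis .
  qed
  define r where "r = 4 / real n"
  have e: "\<bar>e \<bar>t + - pi\<bar>\<bar> \<le> r" "\<bar>e \<bar>t + 0\<bar>\<bar> \<le> r"
    unfolding r_def using eb[of "- pi"] eb[of 0] by auto
  have "integral {0..pi} (G t) \<le> integral {0..pi} (\<lambda>u. 2 * r)"
  proof (rule integral_le[OF intG])
    fix u :: real assume "u \<in> {0..pi}"
    then have "- pi \<le> - u" "- u \<le> pi" "- pi \<le> u" "u \<le> pi" by auto
    note eb[OF this(1,2)] eb[OF this(3,4)]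
    then show "G t u \<le> 2 * r" unfolding G_def r_def by linarith
  qed auto
  then have int: "integral {0..pi} (G t) \<le> 2 * r * pi" by (simp add: mult_ac)
  have "\<bar>f' pi\<bar> * \<bar>e \<bar>t + - pi\<bar>\<bar> + \<bar>f' 0\<bar> * \<bar>e \<bar>t + 0\<bar>\<bar> + B / pi * integral {0..pi} (G t)
      \<le> \<bar>f' pi\<bar> * r + \<bar>f' 0\<bar> * r + B / pi * (2 * r * pi)"
    using B0 by (intro add_mono mult_left_mono e int) auto
  also have "\<dots> = K * r" by (simp add: K_def distrib_right)
  finally show "\<bar>green_rem f' f'' (n - 1) t\<bar> \<le> K * (4 / real n)"
    using pt[OF t] by (simp only: r_def)
qed

text \<open>
  Interpolation itself has an error of order at most \<open>n powr (- 1/2)\<close> at points whose distance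
  from both end points is at least \<open>pi / (2 n)\<close>, uniformly in the shift.
\<close>

lemma lagrange_interpolation_error:
  fixes f f' f'' :: "real \<Rightarrow> real"
  assumes f': "\<And>x. x \<in> {0..pi} \<Longrightarrow> (f has_real_derivative f' x) (at x within {0..pi})"
    and f'': "\<And>x. x \<in> {0..pi} \<Longrightarrow> (f' has_real_derivative f'' x) (at x within {0..pi})"
    and cont: "continuous_on {0..pi} f''" and B: "\<And>x. x \<in> {0..pi} \<Longrightarrow> \<bar>f'' x\<bar> \<le> B"
    and n: "n \<ge> 2" and d: "d \<in> {- (pi / (2 * real n))<..<pi / (2 * real n)}"
    and t: "pi / (2 * real n) \<le> t" "t \<le> pi - pi / (2 * real n)"
  shows "\<bar>(\<Sum>k=1..n. f (shifted_angle n d k) * lagrange_fund n (shifted_angle n d) k t) - f t\<bar>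
    \<le> 156 * (\<bar>f' pi\<bar> + \<bar>f' 0\<bar> + 2 * B) / sqrt (real n)"
proof -
  define K where "K = \<bar>f' pi\<bar> + \<bar>f' 0\<bar> + 2 * B"
  define a where "a = shifted_angle n d"
  define R where "R = green_rem f' f'' (n - 1)"
  have n1: "n \<ge> 1" using n by simp
  have "pi / (2 * real n) > 0" using n by simp
  then have t0: "t \<in> {0..pi}" using t by simp
  have K0: "0 \<le> K" using B[of 0] by (simp add: K_def)
  obtain c where c: "\<And>s. s \<in> {0..pi} \<Longrightarrow> f s = (\<Sum>i\<le>n - 1. c i * cos (real i * s)) + R s"
    unfolding R_def using cos_sum_plus_green_rem[OF f' f'' cont] by metis
  have ak: "a k \<in> {0..pi}" if "k \<in> {1..n}" for k
    using shifted_angle_in[OF n1 d that] by (auto simp: a_def)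
  have "(\<Sum>k=1..n. f (a k) * lagrange_fund n a k t) =
      (\<Sum>k=1..n. (\<Sum>i\<le>n - 1. c i * cos (real i * a k)) * lagrange_fund n a k t)
      + (\<Sum>k=1..n. R (a k) * lagrange_fund n a k t)"
    unfolding sum.distrib[symmetric] using c[OF ak] by (intro sum.cong) (auto simp: distrib_right)
  also have "(\<Sum>k=1..n. (\<Sum>i\<le>n - 1. c i * cos (real i * a k)) * lagrange_fund n a k t) = f t - R t"
    using lagrange_fund_reproduces_cos_sum[OF inj_on_cos_shifted_angle[OF n1 d], of "n - 1" c t] c[OF t0] n
    by (simp add: a_def)
  finally have "\<bar>(\<Sum>k=1..n. f (a k) * lagrange_fund n a k t) - f t\<bar>
      \<le> \<bar>\<Sum>k=1..n. R (a k) * lagrange_fund n a k t\<bar> + \<bar>R t\<bar>" by linarith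
  also have "\<bar>\<Sum>k=1..n. R (a k) * lagrange_fund n a k t\<bar> \<le> (\<Sum>k=1..n. \<bar>R (a k)\<bar> * 4)"
  proof (rule order_trans[OF sum_abs sum_mono])
    fix k assume "k \<in> {1..n}"
    then show "\<bar>R (a k) * lagrange_fund n a k t\<bar> \<le> \<bar>R (a k)\<bar> * 4"
      unfolding abs_mult a_def by (intro mult_left_mono abs_lagrange_fund_le n1 d t) auto
  qed
  also have "\<dots> = 4 * (\<Sum>k=1..n. \<bar>R (a k)\<bar>)"
    by (simp add: sum_distrib_left mult.commute)
  also have "\<dots> \<le> 4 * (K * (38 / sqrt (real n)))"
    unfolding R_def a_def K_def by (intro mult_left_mono green_rem_bounds(1)[OF n d cont B]) auto
  also have "\<bar>R t\<bar> \<le> K * (4 / sqrt (real n))"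
  proof -
    have "\<bar>R t\<bar> \<le> K * (4 / real n)"
      unfolding R_def K_def by (rule green_rem_bounds(2)[OF n d cont B t0])
    also have "sqrt (real n) \<le> real n"
      using n by (intro real_le_lsqrt) (auto simp: power2_eq_square)
    then have "4 / real n \<le> 4 / sqrt (real n)"
      using n by (intro divide_left_mono) auto
    then have "K * (4 / real n) \<le> K * (4 / sqrt (real n))"
      using K0 by (rule mult_left_mono)
    finally show ?thesis .
  qed
  finally show ?thesis by (simp add: a_def K_def[symmetric])
qed

text \<open>
  The points \<open>\<theta> + s pi / (2 n)\<close> may lie outside \<open>[0, pi]\<close> when \<open>\<theta>\<close> is an end point. As only their
  cosines matter, they can be reflected back, and for all large \<open>n\<close> their distance from the end
  points is then at least \<open>pi / (2 n)\<close>.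
\<close>

lemma eventually_half_step_reflected:
  assumes \<theta>: "\<theta> \<in> {0..pi}" and s: "\<bar>s\<bar> = 1"
  shows "\<forall>\<^sub>F n in sequentially. \<exists>t. pi / (2 * real n) \<le> t \<and> t \<le> pi - pi / (2 * real n)
    \<and> cos t = cos (\<theta> + s * (pi / (2 * real n))) \<and> \<bar>t - \<theta>\<bar> \<le> pi / (2 * real n)"
proof -
  have lim: "(\<lambda>n. pi / (2 * real n)) \<longlonglongrightarrow> 0"
    using tendsto_mult[OF tendsto_const[of "pi / 2"] lim_inverse_n] by (simp add: field_simps)
  have n1: "\<forall>\<^sub>F n :: nat in sequentially. n \<ge> 1" by (rule eventually_ge_at_top)
  have s': "s = 1 \<or> s = -1" using s by linarith
  consider "\<theta> = 0" | "\<theta> = pi" | "0 < \<theta>" "\<theta> < pi" using \<theta> by fastforce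
  then show ?thesis
  proof cases
    case 1
    show ?thesis using n1
    proof eventually_elim
      case (elim n)
      have "pi / (2 * real n) \<le> pi / 2" using elim by (intro divide_left_mono) auto
      then show ?case using 1 s' by (intro exI[of _ "pi / (2 * real n)"]) auto
    qed
  next
    case 2
    show ?thesis using n1
    proof eventually_elim
      case (elim n)
      have "pi / (2 * real n) \<le> pi / 2" using elim by (intro divide_left_mono) auto
      then show ?case using 2 s' by (intro exI[of _ "pi - pi / (2 * real n)"]) (auto simp: cos_add cos_diff)
    qed
  next
    case 3
    have "\<forall>\<^sub>F n in sequentially. pi / (2 * real n) < min \<theta> (pi - \<theta>) / 2"
      by (rule order_tendstoD(2)[OF lim]) (use 3 in auto)
    then show ?thesis
    proof eventually_elim
      case (elim n)
      define h where "h = pi / (2 * real n)"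
      have "2 * h < \<theta>" "2 * h < pi - \<theta>" using elim unfolding h_def[symmetric] by auto
      moreover have "0 \<le> h" by (simp add: h_def)
      ultimately show ?case
        unfolding h_def[symmetric] using s' by (intro exI[of _ "\<theta> + s * h"]) auto
    qed
  qed
qed

lemma c2_nonneg: "0 \<le> c2 n"
proof -
  have "summable (\<lambda>k. 1 / real (Suc k) ^ 2)"
    using inverse_power_summable[of 2, where 'a = real]
    by (subst summable_Suc_iff[where f = "\<lambda>k. 1 / real k ^ 2"]) (simp add: inverse_eq_divide)
  then have "0 \<le> (\<Sum>k. (2 * real n / pi) ^ 2 * (1 / real (Suc k) ^ 2))"
    by (intro suminf_nonneg summable_mult) auto
  then show ?thesis unfolding c2_def by (intro add_nonneg_nonneg mult_nonneg_nonneg) auto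
qed

lemma grunwald_error_le:
  fixes f f' f'' :: "real \<Rightarrow> real"
  assumes \<theta>0: "\<And>n. n \<ge> 1 \<Longrightarrow> \<theta>0 n \<in> {- (pi / (2 * real n))<..<pi / (2 * real n)}"
    and f': "\<And>x. x \<in> {0..pi} \<Longrightarrow> (f has_real_derivative f' x) (at x within {0..pi})"
    and f'': "\<And>x. x \<in> {0..pi} \<Longrightarrow> (f' has_real_derivative f'' x) (at x within {0..pi})"
    and cont: "continuous_on {0..pi} f''" and \<theta>: "\<theta> \<in> {0..pi}"
  shows "\<exists>C. \<forall>\<^sub>F n in sequentially. \<bar>grunwald n (shifted_angle n (\<theta>0 n)) f \<theta> - f \<theta>\<bar> \<le> C / sqrt (real n)"
proof -
  have "continuous_on {0..pi} f'" using f'' by (rule DERIV_continuous_on)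
  then have "bounded (f' ` {0..pi})" by (intro compact_imp_bounded compact_continuous_image) auto
  then obtain L where L: "\<And>x. x \<in> {0..pi} \<Longrightarrow> \<bar>f' x\<bar> \<le> L"
    unfolding bounded_iff real_norm_def by blast
  have "bounded (f'' ` {0..pi})" using cont by (intro compact_imp_bounded compact_continuous_image) auto
  then obtain B where B: "\<And>x. x \<in> {0..pi} \<Longrightarrow> \<bar>f'' x\<bar> \<le> B"
    unfolding bounded_iff real_norm_def by blast
  define K where "K = 156 * (\<bar>f' pi\<bar> + \<bar>f' 0\<bar> + 2 * B)"
  have L0: "0 \<le> L" using L[of 0] by simp
  have lip: "\<bar>f t - f \<theta>\<bar> \<le> L * \<bar>t - \<theta>\<bar>" if "t \<in> {0..pi}" for t
    using field_differentiable_bound[of "{0..pi}" f f' L t \<theta>] f' L that \<theta> by auto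
  have "\<forall>\<^sub>F n in sequentially. \<bar>grunwald n (shifted_angle n (\<theta>0 n)) f \<theta> - f \<theta>\<bar> \<le> (K + L * pi) / sqrt (real n)"
    using eventually_half_step_reflected[OF \<theta>, of "-1", simplified] eventually_half_step_reflected[OF \<theta>, of 1, simplified]
      eventually_ge_at_top[of 2]
  proof eventually_elim
    case (elim n)
    define h where "h = pi / (2 * real n)"
    define a where "a = shifted_angle n (\<theta>0 n)"
    define T where "T t = (\<Sum>k=1..n. f (a k) * lagrange_fund n a k t)" for t
    have n: "n \<ge> 2" and d: "\<theta>0 n \<in> {- (pi / (2 * real n))<..<pi / (2 * real n)}"
      using elim(3) \<theta>0 by auto
    have h: "0 < h" using n by (simp add: h_def)
    have mean: "\<bar>x - z\<bar> \<le> b \<Longrightarrow> \<bar>y - z\<bar> \<le> b \<Longrightarrow> \<bar>1 / 2 * (x + y) - z\<bar> \<le> b" for x y z b :: real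
      by argo
    have T: "\<bar>T t - f \<theta>\<bar> \<le> (K + L * pi) / sqrt (real n)" if t: "h \<le> t" "t \<le> pi - h" "\<bar>t - \<theta>\<bar> \<le> h" for t
    proof -
      have "\<bar>T t - f t\<bar> \<le> K / sqrt (real n)"
        unfolding T_def a_def K_def using t lagrange_interpolation_error[OF f' f'' cont B n d]
        by (simp add: h_def)
      moreover have "\<bar>f t - f \<theta>\<bar> \<le> L * pi / sqrt (real n)"
      proof -
        have "\<bar>f t - f \<theta>\<bar> \<le> L * \<bar>t - \<theta>\<bar>" using lip t h by auto
        also have "\<dots> \<le> L * h" using t L0 by (intro mult_left_mono)
        also have "h \<le> pi / sqrt (real n)"
        proof -
          have "sqrt (real n) \<le> 2 * real n"
            using n by (intro real_le_lsqrt) (auto simp: power2_eq_square)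
          then show ?thesis unfolding h_def using n by (intro divide_left_mono) auto
        qed
        then have "L * h \<le> L * (pi / sqrt (real n))" using L0 by (rule mult_left_mono)
        finally show ?thesis by simp
      qed
      ultimately show ?thesis by (simp add: add_divide_distrib)
    qed
    obtain t1 where t1: "h \<le> t1" "t1 \<le> pi - h" "cos t1 = cos (\<theta> - h)" "\<bar>t1 - \<theta>\<bar> \<le> h"
      using elim(1) by (auto simp: h_def)
    obtain t2 where t2: "h \<le> t2" "t2 \<le> pi - h" "cos t2 = cos (\<theta> + h)" "\<bar>t2 - \<theta>\<bar> \<le> h"
      using elim(2) by (auto simp: h_def)
    have "grunwald n a f \<theta> = 1 / 2 * (T t1 + T t2)"
    proof -
      have "lagrange_fund n a k (\<theta> - h) = lagrange_fund n a k t1"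
        "lagrange_fund n a k (\<theta> + h) = lagrange_fund n a k t2" for k
        using t1 t2 by (simp_all add: lagrange_fund_def)
      then show ?thesis
        unfolding grunwald_def h_def[symmetric] T_def by (simp add: sum.distrib distrib_left)
    qed
    then show ?case
      using mean[OF T[OF t1(1,2,4)] T[OF t2(1,2,4)]] by (simp only: a_def)
  qed
  then show ?thesis by blast
qed

theorem theorem3p2:
  fixes f f' f'' :: "real \<Rightarrow> real" and \<theta>0 :: "nat \<Rightarrow> real" and \<theta> M :: real and m :: nat
  assumes \<theta>0: "\<And>n. n \<ge> 1 \<Longrightarrow> \<theta>0 n \<in> {- (pi / (2 * real n))<..<pi / (2 * real n)}"
    and f': "\<And>x. x \<in> {0..pi} \<Longrightarrow> (f has_real_derivative f' x) (at x within {0..pi})"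
    and f'': "\<And>x. x \<in> {0..pi} \<Longrightarrow> (f' has_real_derivative f'' x) (at x within {0..pi})"
    and cont: "continuous_on {0..pi} f''"
    and \<theta>: "\<theta> \<in> {0..pi}"
    and M: "M = (SUP x\<in>{0..pi}. \<bar>f'' x\<bar>)"
    and m: "m \<ge> 1"
  shows "limsup (\<lambda>n. ereal (real n powr (1 / 3) *
             \<bar>grunwald n (shifted_angle n (\<theta>0 n)) f \<theta> - f \<theta>\<bar>))
         \<le> ereal ((9 * pi ^ 4 / 64 + c2 m) * \<bar>f' \<theta>\<bar>
             + 9 * pi ^ 5 / 128 * \<bar>f'' \<theta>\<bar> + 9 * M * pi ^ 5 / 64)"
proof -
  define E where "E n = \<bar>grunwald n (shifted_angle n (\<theta>0 n)) f \<theta> - f \<theta>\<bar>" for n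
  obtain C where C: "\<forall>\<^sub>F n in sequentially. E n \<le> C / sqrt (real n)"
    unfolding E_def using grunwald_error_le[OF \<theta>0 f' f'' cont \<theta>] by blast
  have "(\<lambda>n. real n powr (1 / 3) * E n) \<longlonglongrightarrow> 0"
  proof (rule tendsto_sandwich[OF _ _ tendsto_const])
    have "(\<lambda>n. C * real n powr (- (1 / 6))) \<longlonglongrightarrow> C * 0"
      by (intro tendsto_mult tendsto_const tendsto_neg_powr filterlim_real_sequentially) auto
    then show "(\<lambda>n. C * real n powr (- (1 / 6))) \<longlonglongrightarrow> 0" by simp
    show "\<forall>\<^sub>F n in sequentially. real n powr (1 / 3) * E n \<le> C * real n powr (- (1 / 6))"
      using C eventually_gt_at_top[of 0]
    proof eventually_elim
      case (elim n)
      have "real n powr (1 / 3) * E n \<le> real n powr (1 / 3) * (C / real n powr (1 / 2))"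
        using elim by (intro mult_left_mono) (auto simp: powr_half_sqrt)
      also have "\<dots> = C * (real n powr (1 / 3) / real n powr (1 / 2))" by simp
      also have "real n powr (1 / 3) / real n powr (1 / 2) = real n powr (- (1 / 6))"
        by (simp add: powr_diff[symmetric])
      finally show ?case .
    qed
  qed (auto simp: E_def)
  then have "(\<lambda>n. ereal (real n powr (1 / 3) * E n)) \<longlonglongrightarrow> ereal 0" by simp
  from lim_imp_Limsup[OF sequentially_bot this]
  have lim: "limsup (\<lambda>n. ereal (real n powr (1 / 3) * E n)) = 0" by simp
  have M0: "0 \<le> M"
  proof -
    have "compact ((\<lambda>x. \<bar>f'' x\<bar>) ` {0..pi})"
      by (intro compact_continuous_image continuous_on_rabs cont compact_Icc)
    then have bdd: "bdd_above ((\<lambda>x. \<bar>f'' x\<bar>) ` {0..pi})"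
      by (rule bounded_imp_bdd_above[OF compact_imp_bounded])
    have "\<bar>f'' 0\<bar> \<le> M" unfolding M by (rule cSUP_upper[OF _ bdd]) simp
    then show ?thesis by linarith
  qed
  have "0 \<le> (9 * pi ^ 4 / 64 + c2 m) * \<bar>f' \<theta>\<bar> + 9 * pi ^ 5 / 128 * \<bar>f'' \<theta>\<bar> + 9 * M * pi ^ 5 / 64"
    by (intro add_nonneg_nonneg mult_nonneg_nonneg divide_nonneg_nonneg M0 c2_nonneg) auto
  with lim show ?thesis unfolding E_def by simp
qed

end
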